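(* Let $p:\mathbb{R}\to\mathbb{R}$ be an $L^\infty$ function such that $x'=-x^2+p(t)$ has an attractor-repeller pair $(\tilde a,\tilde r)$, and let $\Gamma:\mathbb{R}\to\mathbb{R}$ be bounded and continuous with finite limits $\lim_{t\to\pm\infty}\Gamma(t)$. For $h\ge0$ consider $$x'=-\big(x-\Gamma^h(t)\big)^2+p(t).\qquad (E_h)$$ Fix $\alpha\in(0,1/2)$ and let $\bar t_1<\bar t_2$ satisfy $\mathfrak{a}_0(\bar t_1)-\Gamma(\bar t_1)>b^{1/2+\alpha}(\bar t_1)$ and $\mathfrak{r}_0(\bar t_2)-\Gamma(\bar t_2)<b^{1/2-\alpha}(\bar t_2)$ (in particular $\mathfrak{a}_0$ is defined at $\bar t_1$ and $\mathfrak{r}_0$ at $\bar t_2$). Assume that $\Gamma$ is $C^2$ on $[\bar t_1,\bar t_2]$, and that $$\left(\frac14-\frac{\alpha^2(\bar t_2+\bar t_1-2t)^2}{(\bar t_2-\bar t_1)^2}\right)(\tilde a(t)-\tilde r(t))^2+\frac{2\alpha}{\bar t_2-\bar t_1}\,(\tilde a(t)-\tilde r(t))>\Gamma'(t)\quad\text{if }t\in[\bar t_1,\bar t_2].$$ Then there exists $h_*>0$ such that $(E_h)$ has an attractor-repeller pair for all $h\in[0,h_*]$.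
   Context: Solutions are Carathéodory solutions (absolutely continuous on compact intervals, satisfying the equation for a.e. $t$). For $h>0$, $\Gamma^h(t):=\Gamma(jh)$ for $t\in[jh,(j+1)h)$, $j\in\mathbb{Z}$; and $\Gamma^0:=\Gamma$. $b^\nu:=\nu\,\tilde a+(1-\nu)\,\tilde r$ for $\nu\in[0,1]$. Attractor-repeller pair for $x'=-(x-\Delta(t))^2+q(t)$ ($\Delta,q\in L^\infty(\mathbb{R})$): the pair $(a,r)$ formed by the maximal and minimal bounded solutions on $\mathbb{R}$, when they exist and are hyperbolic with $a$ attractive and $r$ repulsive: there exist $k\ge1,\beta>0$ with $\exp\int_s^t-2(a(l)-\Delta(l))\,dl\le ke^{-\beta(t-s)}$ for $t\ge s$ and $\exp\int_s^t-2(r(l)-\Delta(l))\,dl\le ke^{\beta(t-s)}$ for $t\le s$. This is equivalent to $a,r$ existing with $\inf_{t\in\mathbb{R}}(a(t)-r(t))>0$. Special solutions of $(E_h)$: $\mathfrak{a}_h$ is the maximal solution, defined on $\mathbb{R}$ or on an open half-line unbounded below, such that for each $s$ in its domain the solution with value $x_0$ at $s$ remains bounded as $t\to-\infty$ iff $x_0\le\mathfrak{a}_h(s)$, and which tends to $-\infty$ at the right end of its domain if this is finite. $\mathfrak{r}_h$ is the maximal solution, defined on $\mathbb{R}$ or on an open half-line unbounded above, such that for each $s$ in its domain the solution with value $x_0$ at $s$ remains bounded as $t\to+\infty$ iff $x_0\ge\mathfrak{r}_h(s)$, and which tends to $+\infty$ at the left end of its domain if this is finite. Both exist under the present hypotheses.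 *)

theory Defs
  imports "HOL-Analysis.Analysis"
begin

definition Linfty :: "(real \<Rightarrow> real) \<Rightarrow> bool" where
  "Linfty f \<longleftrightarrow> f \<in> borel_measurable lebesgue \<and> (\<exists>B. AE t in lebesgue. \<bar>f t\<bar> \<le> B)"

definition abs_continuous_on :: "real set \<Rightarrow> (real \<Rightarrow> real) \<Rightarrow> bool" where
  "abs_continuous_on I f \<longleftrightarrow>
    (\<forall>\<epsilon>>0. \<exists>\<delta>>0. \<forall>F. finite F \<longrightarrow>
       (\<forall>(u, v)\<in>F. u \<le> v \<and> {u..v} \<subseteq> I) \<longrightarrow>
       disjoint_family_on (\<lambda>(u, v). {u<..<v}) F \<longrightarrow>
       (\<Sum>(u, v)\<in>F. v - u) < \<delta> \<longrightarrow>
       (\<Sum>(u, v)\<in>F. \<bar>f v - f u\<bar>) < \<epsilon>)"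

text \<open>Functions are total, so a solution of \<open>x' = g t x\<close> on an interval \<open>I\<close> is a function whose
  values outside \<open>I\<close> are irrelevant.\<close>

definition caratheodory_solution ::
    "(real \<Rightarrow> real \<Rightarrow> real) \<Rightarrow> real set \<Rightarrow> (real \<Rightarrow> real) \<Rightarrow> bool" where
  "caratheodory_solution g I x \<longleftrightarrow> is_interval I \<and>
     (\<forall>c d. {c..d} \<subseteq> I \<longrightarrow> abs_continuous_on {c..d} x) \<and>
     (AE t in lebesgue. t \<in> I \<longrightarrow> (x has_real_derivative g t (x t)) (at t within I))"

definition maximal_solution ::
    "(real \<Rightarrow> real \<Rightarrow> real) \<Rightarrow> real set \<Rightarrow> (real \<Rightarrow> real) \<Rightarrow> bool" where
  "maximal_solution g I x \<longleftrightarrow> caratheodory_solution g I x \<and>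
     (\<forall>J y. caratheodory_solution g J y \<longrightarrow> I \<subseteq> J \<longrightarrow> (\<forall>t\<in>I. y t = x t) \<longrightarrow> J = I)"

definition quad_rhs :: "(real \<Rightarrow> real) \<Rightarrow> (real \<Rightarrow> real) \<Rightarrow> real \<Rightarrow> real \<Rightarrow> real" where
  "quad_rhs \<Delta> q t x = - (x - \<Delta> t)\<^sup>2 + q t"

definition bounded_solution :: "(real \<Rightarrow> real \<Rightarrow> real) \<Rightarrow> (real \<Rightarrow> real) \<Rightarrow> bool" where
  "bounded_solution g x \<longleftrightarrow> caratheodory_solution g UNIV x \<and> bounded (range x)"

text \<open>The integrals are oriented: for \<open>t < s\<close>, \<open>LINT l=s..t\<close> is minus the integral from \<open>t\<close> to \<open>s\<close>.
  They are taken over \<open>lebesgue\<close> since \<open>\<Delta>\<close> need not be Borel measurable.\<close>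

definition attractor_repeller_pair ::
    "(real \<Rightarrow> real) \<Rightarrow> (real \<Rightarrow> real) \<Rightarrow> (real \<Rightarrow> real) \<Rightarrow> (real \<Rightarrow> real) \<Rightarrow> bool" where
  "attractor_repeller_pair \<Delta> q a r \<longleftrightarrow>
     bounded_solution (quad_rhs \<Delta> q) a \<and>
     bounded_solution (quad_rhs \<Delta> q) r \<and>
     (\<forall>x. bounded_solution (quad_rhs \<Delta> q) x \<longrightarrow> (\<forall>t. r t \<le> x t \<and> x t \<le> a t)) \<and>
     (\<exists>k\<ge>1. \<exists>\<beta>>0.
        (\<forall>s t. s \<le> t \<longrightarrow>
           exp (LINT l=ereal s..ereal t|lebesgue. (- 2 * (a l - \<Delta> l))) \<le> k * exp (- \<beta> * (t - s))) \<and>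
        (\<forall>s t. t \<le> s \<longrightarrow>
           exp (LINT l=ereal s..ereal t|lebesgue. (- 2 * (r l - \<Delta> l))) \<le> k * exp (\<beta> * (t - s))))"

definition has_attractor_repeller_pair :: "(real \<Rightarrow> real) \<Rightarrow> (real \<Rightarrow> real) \<Rightarrow> bool" where
  "has_attractor_repeller_pair \<Delta> q \<longleftrightarrow> (\<exists>a r. attractor_repeller_pair \<Delta> q a r)"

text \<open>For \<open>h > 0\<close>, \<open>\<lfloor>t / h\<rfloor>\<close> is the integer \<open>j\<close> with \<open>t \<in> [j h, (j + 1) h)\<close>.  Only \<open>h \<ge> 0\<close> is
  meaningful.\<close>

definition step_approx :: "real \<Rightarrow> (real \<Rightarrow> real) \<Rightarrow> real \<Rightarrow> real" where
  "step_approx h \<Gamma> t = (if h > 0 then \<Gamma> (of_int \<lfloor>t / h\<rfloor> * h) else \<Gamma> t)"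

text \<open>The special solutions \<open>\<aa>\<close> and \<open>\<rr>\<close>, as relations between the equation, the domain \<open>D\<close> and the
  function.  The solution with value \<open>x0\<close> at \<open>s\<close> may blow up in finite time, so its remaining
  bounded includes that it exists on the whole half-line.\<close>

definition special_solution_a ::
    "(real \<Rightarrow> real) \<Rightarrow> (real \<Rightarrow> real) \<Rightarrow> real set \<Rightarrow> (real \<Rightarrow> real) \<Rightarrow> bool" where
  "special_solution_a \<Delta> q D a \<longleftrightarrow>
     maximal_solution (quad_rhs \<Delta> q) D a \<and>
     (D = UNIV \<or> (\<exists>c. D = {..<c})) \<and>
     (\<forall>s\<in>D. \<forall>x0.
        (\<exists>y. caratheodory_solution (quad_rhs \<Delta> q) {..s} y \<and> y s = x0 \<and> Bfun y at_bot)
          \<longleftrightarrow> x0 \<le> a s) \<and>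
     (\<forall>c. D = {..<c} \<longrightarrow> filterlim a at_bot (at_left c))"

definition special_solution_r ::
    "(real \<Rightarrow> real) \<Rightarrow> (real \<Rightarrow> real) \<Rightarrow> real set \<Rightarrow> (real \<Rightarrow> real) \<Rightarrow> bool" where
  "special_solution_r \<Delta> q D r \<longleftrightarrow>
     maximal_solution (quad_rhs \<Delta> q) D r \<and>
     (D = UNIV \<or> (\<exists>c. D = {c<..})) \<and>
     (\<forall>s\<in>D. \<forall>x0.
        (\<exists>y. caratheodory_solution (quad_rhs \<Delta> q) {s..} y \<and> y s = x0 \<and> Bfun y at_top)
          \<longleftrightarrow> r s \<le> x0) \<and>
     (\<forall>c. D = {c<..} \<longrightarrow> filterlim r at_top (at_right c))"

definition convex_comb :: "(real \<Rightarrow> real) \<Rightarrow> (real \<Rightarrow> real) \<Rightarrow> real \<Rightarrow> real \<Rightarrow> real" where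
  "convex_comb a r \<nu> t = \<nu> * a t + (1 - \<nu>) * r t"

end

theory Submission
  imports Defs
begin

text \<open>A function whose derivative stays strictly below the right-hand side by a uniform amount (a
  strict lower function, possibly with downward jumps) separates an attractor from a repeller: the
  maximal bounded solution lies above it by a fixed amount and, by the symmetry \<open>x \<mapsto> - x (- \<cdot>)\<close>, the minimal one lies
  below it.  Hyperbolicity then follows from \<open>inf (a - r) > 0\<close>, because \<open>u = a - r\<close> satisfies
  \<open>- 2 (a - \<Delta>) = u'/u - u\<close> and \<open>- 2 (r - \<Delta>) = u'/u + u\<close>.  Being a strict lower function with slack
  survives a uniformly small change of \<open>\<Gamma>\<close>, so one such function for \<open>\<Gamma>\<close> settles all small \<open>h\<close> at once.
  It is assembled from three pieces: a perturbation of \<open>\<aa>\<^sub>0\<close> on \<open>(-\<infinity>, t1]\<close>, the moving convex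
  combination \<open>\<nu> a + (1 - \<nu>) r + \<Gamma>\<close> with \<open>\<nu>\<close> affine from \<open>1/2 + \<alpha>\<close> to \<open>1/2 - \<alpha>\<close> on \<open>[t1, t2]\<close>, for
  which strictness is exactly the assumed inequality, and a perturbation of \<open>\<rr>\<^sub>0\<close> on \<open>[t2, \<infinity>)\<close>.\<close>

section \<open>Absolute continuity and differentiation almost everywhere\<close>

text \<open>The data are only measurable and the equation holds only almost everywhere. Solutions
  are therefore rewritten as identities between gauge integrals over compact intervals, and
  \<open>p\<close> is replaced by a bounded Borel representative, so that later bounds hold at every
  \<open>t\<close>. In this form comparison rests on one fact, that a bounded quantity under linear
  decay cannot be positive, and the maximal bounded solution arises by iterating a linear equation
  whose bounded solution is an explicit integral. The real obstacle is slack on unbounded time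
  intervals: \<open>a0\<close> and \<open>r0\<close> satisfy the equation with equality and leave no
  room for a change of \<open>\<Gamma>\<close>. Room comes from the strict concavity of -x^2: far
  out \<open>\<Gamma>\<close> is nearly constant, \<open>a\<close> and \<open>r\<close> stay a fixed
  distance apart, and their midpoint shifted by the limit of \<open>\<Gamma>\<close> has slack. This
  slack is carried to \<open>t1\<close> (and, reflected, to \<open>t2\<close>) at an arbitrarily
  small cost in height, for which the strict inequalities assumed at \<open>t1\<close> and
  \<open>t2\<close> pay.\<close>

lemma lipschitz_imp_abs_continuous_on:
  fixes f :: "real \<Rightarrow> real"
  assumes L: "C-lipschitz_on I f"
  shows "abs_continuous_on I f"
  unfolding abs_continuous_on_def
proof (intro allI impI)
  fix \<epsilon> :: real assume e: "\<epsilon> > 0"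
  have C: "C \<ge> 0" using L by (rule lipschitz_on_nonneg)
  show "\<exists>\<delta>>0. \<forall>F. finite F \<longrightarrow> (\<forall>(u, v)\<in>F. u \<le> v \<and> {u..v} \<subseteq> I) \<longrightarrow>
       disjoint_family_on (\<lambda>(u, v). {u<..<v}) F \<longrightarrow> (\<Sum>(u, v)\<in>F. v - u) < \<delta> \<longrightarrow>
       (\<Sum>(u, v)\<in>F. \<bar>f v - f u\<bar>) < \<epsilon>"
  proof (intro exI[of _ "\<epsilon> / (C + 1)"] conjI allI impI)
    show "\<epsilon> / (C + 1) > 0" using e C by simp
    fix F :: "(real \<times> real) set"
    assume F: "\<forall>(u, v)\<in>F. u \<le> v \<and> {u..v} \<subseteq> I" and s: "(\<Sum>(u, v)\<in>F. v - u) < \<epsilon> / (C + 1)"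
    have nn: "(\<Sum>(u, v)\<in>F. v - u) \<ge> 0" using F by (intro sum_nonneg) auto
    have "(\<Sum>(u, v)\<in>F. \<bar>f v - f u\<bar>) \<le> (\<Sum>(u, v)\<in>F. C * (v - u))"
    proof (rule sum_mono, clarify)
      fix u v assume "(u, v) \<in> F"
      then have uv: "u \<le> v" "u \<in> I" "v \<in> I" using F by fastforce+
      show "\<bar>f v - f u\<bar> \<le> C * (v - u)"
        using lipschitz_onD[OF L uv(3,2)] uv(1) by (simp add: dist_real_def)
    qed
    also have "\<dots> = C * (\<Sum>(u, v)\<in>F. v - u)" by (simp add: sum_distrib_left case_prod_beta)
    also have "\<dots> \<le> (C + 1) * (\<Sum>(u, v)\<in>F. v - u)" using nn by (simp add: algebra_simps)
    also have "\<dots> < (C + 1) * (\<epsilon> / (C + 1))" using s C by (intro mult_strict_left_mono) auto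
    also have "\<dots> = \<epsilon>" using C by simp
    finally show "(\<Sum>(u, v)\<in>F. \<bar>f v - f u\<bar>) < \<epsilon>" .
  qed
qed

lemma abs_continuous_on_imp_continuous_on:
  assumes ac: "abs_continuous_on {a..b} f"
  shows "continuous_on {a..b} f"
  unfolding continuous_on_iff
proof (intro ballI allI impI)
  fix x \<epsilon> :: real assume x: "x \<in> {a..b}" and e: "\<epsilon> > 0"
  from ac e obtain d where d: "d > 0" and D: "\<And>F. finite F \<Longrightarrow>
       (\<forall>(u, v)\<in>F. u \<le> v \<and> {u..v} \<subseteq> {a..b}) \<Longrightarrow>
       disjoint_family_on (\<lambda>(u, v). {u<..<v}) F \<Longrightarrow>
       (\<Sum>(u, v)\<in>F. v - u) < d \<Longrightarrow> (\<Sum>(u, v)\<in>F. \<bar>f v - f u\<bar>) < \<epsilon>"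
    unfolding abs_continuous_on_def by meson
  have "dist (f y) (f x) < \<epsilon>" if "y \<in> {a..b}" "dist y x < d" for y
    using D[of "{(min x y, max x y)}"] that x
    by (cases "x \<le> y") (auto simp: disjoint_family_on_def dist_real_def min_def max_def abs_if split: if_splits)
  then show "\<exists>d>0. \<forall>x'\<in>{a..b}. dist x' x < d \<longrightarrow> dist (f x') (f x) < \<epsilon>"
    using d by blast
qed

text \<open>Off the null set \<open>N\<close> of bad points the local linear approximation controls
  the Riemann sum. For tags in \<open>N\<close> the gauge confines the intervals to an open set
  \<open>U\<close> of small measure, where absolute continuity makes the increments of
  \<open>f\<close> small. The gauge integral delivers integrability of \<open>g\<close> together
  with the value.\<close>

lemma abs_continuous_has_integral:
  fixes f g :: "real \<Rightarrow> real"
  assumes ab: "a \<le> b" and ac: "abs_continuous_on {a..b} f"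
    and der: "AE t in lebesgue. t \<in> {a..b} \<longrightarrow> (f has_real_derivative g t) (at t within {a..b})"
  shows "(g has_integral f b - f a) {a..b}"
proof -
  obtain N where Nsub: "{x\<in>space lebesgue. \<not> (x \<in> {a..b} \<longrightarrow> (f has_real_derivative g x) (at x within {a..b}))} \<subseteq> N"
    and N0: "emeasure lebesgue N = 0" and Ns: "N \<in> sets lebesgue"
    using AE_E[OF der] by blast
  \<comment> \<open>\<open>g\<close> is arbitrary on \<open>N\<close>. With the value 0 there, tags
    in \<open>N\<close> contribute only increments of \<open>f\<close>.\<close>
  define g' where "g' x = (if x \<in> N then 0 else g x)" for x
  have neg: "negligible N" using N0 Ns by (simp add: negligible_iff_null_sets null_sets_def)
  have dg: "(f has_real_derivative g x) (at x within {a..b})" if "x \<in> {a..b}" "x \<notin> N" for x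
    using Nsub that by auto
  have "(g' has_integral f b - f a) {a..b}"
    unfolding has_integral_real
  proof (intro allI impI)
    fix e :: real assume e: "e > 0"
    \<comment> \<open>The errors at good tags add up to at most e' (b - a), hence to e / 2; the
      \<open>+ 1\<close> covers the case a = b.\<close>
    define e' where "e' = e / (2 * (b - a + 1))"
    have e': "e' > 0" using e ab by (simp add: e'_def)
    from ac half_gt_zero[OF e] obtain d where d: "d > 0" and D: "\<And>F. finite F \<Longrightarrow>
       (\<forall>(u, v)\<in>F. u \<le> v \<and> {u..v} \<subseteq> {a..b}) \<Longrightarrow>
       disjoint_family_on (\<lambda>(u, v). {u<..<v}) F \<Longrightarrow>
       (\<Sum>(u, v)\<in>F. v - u) < d \<Longrightarrow> (\<Sum>(u, v)\<in>F. \<bar>f v - f u\<bar>) < e / 2"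
      unfolding abs_continuous_on_def by meson
    obtain U where U: "open U" "N \<subseteq> U" and UN: "emeasure lebesgue (U - N) < ennreal d"
      by (rule sets_lebesgue_outer_open[OF Ns d])
    have emU: "emeasure lebesgue U < ennreal d"
    proof -
      have "U = (U - N) \<union> N" using U by auto
      moreover have "U - N \<in> sets lebesgue" using U Ns by (auto intro: borel_open)
      ultimately have "emeasure lebesgue U \<le> emeasure lebesgue (U - N) + emeasure lebesgue N"
        using emeasure_subadditive[of "U - N" lebesgue N] Ns by metis
      also have "\<dots> < ennreal d" using N0 UN by simp
      finally show ?thesis .
    qed
    have "\<exists>r>0. \<forall>y\<in>{a..b}. \<bar>y - x\<bar> < r \<longrightarrow> \<bar>f y - f x - g x * (y - x)\<bar> \<le> e' * \<bar>y - x\<bar>"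
      if "x \<in> {a..b}" "x \<notin> N" for x
    proof -
      have "(f has_derivative (\<lambda>h. g x * h)) (at x within {a..b})"
        using dg[OF that] by (simp add: has_field_derivative_def)
      then show ?thesis unfolding has_derivative_within_alt using e' by auto
    qed
    then obtain r where r: "\<And>x. x \<in> {a..b} \<Longrightarrow> x \<notin> N \<Longrightarrow> r x > 0"
      and rb: "\<And>x y. x \<in> {a..b} \<Longrightarrow> x \<notin> N \<Longrightarrow> y \<in> {a..b} \<Longrightarrow> \<bar>y - x\<bar> < r x \<Longrightarrow>
          \<bar>f y - f x - g x * (y - x)\<bar> \<le> e' * \<bar>y - x\<bar>"
      by metis
    define \<gamma> where "\<gamma> x = (if x \<in> N then U else if x \<in> {a..b} then ball x (r x) else UNIV)" for x
    have gauge: "gauge \<gamma>"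
      unfolding gauge_def \<gamma>_def using U r by auto
    show "\<exists>\<gamma>. gauge \<gamma> \<and> (\<forall>\<D>. \<D> tagged_division_of {a..b} \<and> \<gamma> fine \<D> \<longrightarrow>
        norm ((\<Sum>(x, k)\<in>\<D>. measure lborel k *\<^sub>R g' x) - (f b - f a)) < e)"
    proof (intro exI[of _ \<gamma>] conjI gauge allI impI, elim conjE)
      fix \<D> assume td: "\<D> tagged_division_of {a..b}" and fine: "\<gamma> fine \<D>"
      have fin: "finite \<D>" using td by auto
      have mem: "\<exists>u v. k = {u..v} \<and> u \<le> x \<and> x \<le> v \<and> a \<le> u \<and> v \<le> b" if xk: "(x, k) \<in> \<D>" for x k
      proof -
        obtain u v where k: "k = cbox u v" using tagged_division_ofD(4)[OF td xk] by blast
        have "x \<in> k" "k \<subseteq> {a..b}" using tagged_division_ofD(2,3)[OF td xk] by auto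
        then show ?thesis using k by (intro exI[of _ u] exI[of _ v]) auto
      qed
      have kint: "k = {Inf k..Sup k}" "Inf k \<le> x" "x \<le> Sup k" "a \<le> Inf k" "Sup k \<le> b"
        "measure lborel k = Sup k - Inf k" "interior k = {Inf k<..<Sup k}" if "(x, k) \<in> \<D>" for x k
        using mem[OF that] by (auto simp: interior_atLeastAtMost_real)
      have inter: "interior k \<inter> interior k' = {}" if "(x,k) \<in> \<D>" "(x',k') \<in> \<D>" "(x,k) \<noteq> (x',k')" for x k x' k'
        using tagged_division_ofD(5)[OF td that] .
      have tot: "(\<Sum>(x, k)\<in>\<D>. f (Sup k) - f (Inf k)) = f b - f a"
        using additive_tagged_division_1[OF ab td] .
      have totc: "(\<Sum>(x, k)\<in>\<D>. measure lborel k) = b - a"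
        using additive_content_tagged_division[of \<D> a b] td ab by simp
      define \<D>1 where "\<D>1 = {(x, k) \<in> \<D>. x \<in> N}"
      define \<D>2 where "\<D>2 = {(x, k) \<in> \<D>. x \<notin> N}"
      have split: "\<D> = \<D>1 \<union> \<D>2" "\<D>1 \<inter> \<D>2 = {}" by (auto simp: \<D>1_def \<D>2_def)
      have fin12: "finite \<D>1" "finite \<D>2" using fin split by auto
      let ?h = "\<lambda>(x, k). measure lborel k *\<^sub>R g' x - (f (Sup k) - f (Inf k))"
      have eq: "(\<Sum>(x, k)\<in>\<D>. measure lborel k *\<^sub>R g' x) - (f b - f a) = sum ?h \<D>1 + sum ?h \<D>2"
        unfolding tot[symmetric] sum_subtractf[symmetric]
        using sum.union_disjoint[OF fin12 split(2), of ?h] split(1) by (simp add: case_prod_beta)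
      have "\<bar>sum ?h \<D>2\<bar> \<le> (\<Sum>(x, k)\<in>\<D>2. e' * measure lborel k)"
      proof (rule order_trans[OF sum_abs sum_mono], clarify)
        fix x k assume "(x, k) \<in> \<D>2"
        then have xk: "(x, k) \<in> \<D>" and xN: "x \<notin> N" by (auto simp: \<D>2_def)
        note K = kint[OF xk]
        have xab: "x \<in> {a..b}" using K by auto
        have "k \<subseteq> \<gamma> x" using fine xk by (auto simp: fine_def)
        then have "k \<subseteq> ball x (r x)" using xN xab by (simp add: \<gamma>_def)
        moreover have "Inf k \<in> k" "Sup k \<in> k"
          using mem[OF xk] by auto
        ultimately have near: "\<bar>Inf k - x\<bar> < r x" "\<bar>Sup k - x\<bar> < r x"
          by (auto simp: dist_real_def abs_minus_commute)
        have "\<bar>f (Sup k) - f x - g x * (Sup k - x)\<bar> \<le> e' * (Sup k - x)"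
          "\<bar>f (Inf k) - f x - g x * (Inf k - x)\<bar> \<le> e' * (x - Inf k)"
          using rb[OF xab xN _ near(1)] rb[OF xab xN _ near(2)] K by auto
        then have "\<bar>g x * (Sup k - Inf k) - (f (Sup k) - f (Inf k))\<bar> \<le> e' * (Sup k - Inf k)"
          by (simp add: algebra_simps abs_le_iff)
        then show "\<bar>measure lborel k *\<^sub>R g' x - (f (Sup k) - f (Inf k))\<bar> \<le> e' * measure lborel k"
          using xN K(6) by (simp add: g'_def mult.commute)
      qed
      also have "\<dots> \<le> (\<Sum>(x, k)\<in>\<D>. e' * measure lborel k)"
        using e' split(1) fin by (intro sum_mono2) auto
      also have "\<dots> = e' * (b - a)"
        unfolding totc[symmetric] by (simp add: sum_distrib_left case_prod_beta)
      also have "\<dots> \<le> e / 2" using e ab by (simp add: e'_def field_simps)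
      finally have b2: "\<bar>sum ?h \<D>2\<bar> \<le> e / 2" .
      define F where "F = (\<lambda>(x, k). (Inf k, Sup k)) ` \<D>1"
      have b1: "\<bar>sum ?h \<D>1\<bar> < e / 2"
      proof -
        \<comment> \<open>Passing from tagged intervals to the set \<open>F\<close> of endpoint
          pairs can identify two of them, but only degenerate ones, whose increments vanish.\<close>
        have nontriv: "Inf k = Sup k" if A: "(x,k) \<in> \<D>1" "(x',k') \<in> \<D>1" "(x,k) \<noteq> (x',k')"
           "Inf k = Inf k'" "Sup k = Sup k'" for x k x' k'
        proof -
          have B: "(x,k) \<in> \<D>" "(x',k') \<in> \<D>" using A by (auto simp: \<D>1_def)
          have "{Inf k<..<Sup k} = {}"
            using inter[OF B A(3)] kint(7)[OF B(1)] kint(7)[OF B(2)] A(4,5) by simp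
          then show ?thesis using kint(2,3)[OF B(1)] by (simp add: greaterThanLessThan_empty_iff)
        qed
        have "\<bar>sum ?h \<D>1\<bar> \<le> (\<Sum>(x, k)\<in>\<D>1. \<bar>f (Sup k) - f (Inf k)\<bar>)"
          by (rule order_trans[OF sum_abs]) (auto intro!: sum_mono simp: \<D>1_def g'_def)
        also have "\<dots> = (\<Sum>(u, v)\<in>F. \<bar>f v - f u\<bar>)"
          unfolding F_def
        proof (subst sum.reindex_nontrivial[OF fin12(1)])
          fix z w assume "z \<in> \<D>1" "w \<in> \<D>1" "z \<noteq> w"
            "(case z of (x, k) \<Rightarrow> (Inf k, Sup k)) = (case w of (x, k) \<Rightarrow> (Inf k, Sup k))"
          then have "Inf (snd z) = Sup (snd z)"
            using nontriv[of "fst z" "snd z" "fst w" "snd w"] by (simp add: case_prod_beta)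
          then show "(case case z of (x, k) \<Rightarrow> (Inf k, Sup k) of (u, v) \<Rightarrow> \<bar>f v - f u\<bar>) = 0"
            by (simp add: case_prod_beta)
        qed (simp add: case_prod_beta o_def)
        also have "\<dots> < e / 2"
        proof (rule D)
          show "finite F" using fin12 by (simp add: F_def)
          show "\<forall>(u, v)\<in>F. u \<le> v \<and> {u..v} \<subseteq> {a..b}"
            using kint(2,3,4,5) by (fastforce simp: F_def \<D>1_def)
          show dj: "disjoint_family_on (\<lambda>(u, v). {u<..<v}) F"
            unfolding disjoint_family_on_def
          proof (intro ballI impI)
            fix m n assume "m \<in> F" "n \<in> F" and mn: "m \<noteq> n"
            then obtain x k x' k' where B: "(x,k) \<in> \<D>" "(x',k') \<in> \<D>"
              and m: "m = (Inf k, Sup k)" "n = (Inf k', Sup k')"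
              by (auto simp: F_def \<D>1_def)
            have "(x,k) \<noteq> (x',k')" using mn m by auto
            from inter[OF B this]
            show "(case m of (u, v) \<Rightarrow> {u<..<v}) \<inter> (case n of (u, v) \<Rightarrow> {u<..<v}) = {}"
              using m kint(7)[OF B(1)] kint(7)[OF B(2)] by simp
          qed
          have sub: "(\<Union>(u, v)\<in>F. {u<..<v}) \<subseteq> U"
          proof -
            have "{Inf k<..<Sup k} \<subseteq> U" if "(x, k) \<in> \<D>1" for x k
            proof -
              have B: "(x, k) \<in> \<D>" "x \<in> N" using that by (auto simp: \<D>1_def)
              then have "k \<subseteq> U" using fine by (force simp: fine_def \<gamma>_def)
              then show ?thesis using kint(7)[OF B(1)] interior_subset by blast
            qed
            then show ?thesis by (auto simp: F_def)
          qed
          have "ennreal (\<Sum>(u, v)\<in>F. v - u) = (\<Sum>(u, v)\<in>F. emeasure lebesgue {u<..<v})"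
            using \<open>\<forall>(u, v)\<in>F. u \<le> v \<and> {u..v} \<subseteq> {a..b}\<close>
            by (subst sum_ennreal[symmetric]) (auto intro!: sum.cong)
          also have "\<dots> = emeasure lebesgue (\<Union>(u, v)\<in>F. {u<..<v})"
          proof -
            have "(\<lambda>(u::real, v). {u<..<v}) ` F \<subseteq> sets lebesgue" by auto
            from sum_emeasure[OF this dj \<open>finite F\<close>] show ?thesis
              by (simp add: case_prod_beta)
          qed
          also have "\<dots> \<le> emeasure lebesgue U" using sub U by (intro emeasure_mono) auto
          also have "\<dots> < ennreal d" by (rule emU)
          finally show "(\<Sum>(u, v)\<in>F. v - u) < d"
            using ennreal_leI leD linorder_le_less_linear by blast
        qed
        finally show ?thesis .
      qed
      show "norm ((\<Sum>(x, k)\<in>\<D>. measure lborel k *\<^sub>R g' x) - (f b - f a)) < e"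
        unfolding eq using b1 b2 by simp
    qed
  qed
  then show ?thesis
    by (rule has_integral_spike[OF neg, rotated]) (simp add: g'_def)
qed

text \<open>\<open>integrable_ccontinuous_explicit\<close> controls the right difference quotients
  of an indefinite integral. Applied to the reflected integrand it controls the left ones, off the
  mirror image of a second null set.\<close>

lemma lebesgue_differentiation:
  fixes f F :: "real \<Rightarrow> real"
  assumes I: "\<And>s t. s \<le> t \<Longrightarrow> (f has_integral F t - F s) {s..t}"
  shows "AE t in lebesgue. (F has_real_derivative f t) (at t)"
proof -
  have "f integrable_on cbox a b" for a b
    using I[of a b] by (cases "a \<le> b") (auto simp: integrable_on_def)
  from integrable_ccontinuous_explicit[of f, OF this] obtain N1 where N1: "negligible N1" and
    d1: "\<And>x e. \<lbrakk>x \<notin> N1; 0 < e\<rbrakk> \<Longrightarrow> \<exists>d>0. \<forall>h. 0 < h \<and> h < d \<longrightarrow>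
      norm (integral (cbox x (x + h *\<^sub>R One)) f /\<^sub>R h ^ DIM(real) - f x) < e" by metis
  have I': "((\<lambda>x. f (- x)) has_integral F (- s) - F (- t)) {s..t}" if "s \<le> t" for s t
    using has_integral_reflect_lemma_real[OF I[of "-t" "-s"]] that by simp
  have "(\<lambda>x. f (- x)) integrable_on cbox a b" for a b
    using I'[of a b] by (cases "a \<le> b") (auto simp: integrable_on_def)
  from integrable_ccontinuous_explicit[of "\<lambda>x. f (- x)", OF this] obtain N2 where N2: "negligible N2" and
    d2: "\<And>x e. \<lbrakk>x \<notin> N2; 0 < e\<rbrakk> \<Longrightarrow> \<exists>d>0. \<forall>h. 0 < h \<and> h < d \<longrightarrow>
      norm (integral (cbox x (x + h *\<^sub>R One)) (\<lambda>x. f (- x)) /\<^sub>R h ^ DIM(real) - f (- x)) < e" by metis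
  have "negligible (uminus ` N2)" 
  proof (rule negligible_locally_Lipschitz_image[OF _ N2])
    fix x
    show "\<exists>T B. open T \<and> x \<in> T \<and> (\<forall>y\<in>N2 \<inter> T. norm (- y - - x) \<le> B * norm (y - x))"
      by (intro exI[of _ UNIV] exI[of _ 1]) auto
  qed simp
  with N1 have neg: "N1 \<union> uminus ` N2 \<in> null_sets lebesgue"
    by (simp add: negligible_iff_null_sets[symmetric])
  have "(F has_real_derivative f x) (at x)" if x1: "x \<notin> N1" and x2: "x \<notin> uminus ` N2" for x
    unfolding DERIV_def
  proof (rule LIM_I)
    fix e :: real assume e: "e > 0"
    have mx: "- x \<notin> N2" using x2 by (metis image_eqI minus_minus)
    obtain \<delta>1 where \<delta>1: "\<delta>1 > 0" "\<And>h. 0 < h \<Longrightarrow> h < \<delta>1 \<Longrightarrow> \<bar>(F (x + h) - F x) / h - f x\<bar> < e"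
      using d1[OF x1 e] integral_unique[OF I] by (auto simp: divide_inverse_commute)
    obtain \<delta>2 where \<delta>2: "\<delta>2 > 0" "\<And>h. 0 < h \<Longrightarrow> h < \<delta>2 \<Longrightarrow> \<bar>(F x - F (x - h)) / h - f x\<bar> < e"
      using d2[OF mx e] integral_unique[OF I'] by (auto simp: divide_inverse_commute)
    show "\<exists>s>0. \<forall>h. h \<noteq> 0 \<and> norm (h - 0) < s \<longrightarrow> norm ((F (x + h) - F x) / h - f x) < e"
    proof (intro exI[of _ "min \<delta>1 \<delta>2"] conjI allI impI)
      fix h :: real assume h: "h \<noteq> 0 \<and> norm (h - 0) < min \<delta>1 \<delta>2"
      show "norm ((F (x + h) - F x) / h - f x) < e"
      proof (cases "h > 0")
        case True then show ?thesis using \<delta>1(2)[of h] h by simp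
      next
        case False
        have "(F (x + h) - F x) / h = (F x - F (x - (- h))) / (- h)"
          using h by (simp add: field_simps)
        then show ?thesis using \<delta>2(2)[of "- h"] h False by simp
      qed
    qed (use \<delta>1 \<delta>2 in simp)
  qed
  then show ?thesis by (intro AE_I'[OF neg]) auto
qed

section \<open>Lipschitz estimates and the damped linear equation\<close>

lemma has_integral_imp_lipschitz_on:
  fixes f g :: "real \<Rightarrow> real"
  assumes I: "\<And>s t. a \<le> s \<Longrightarrow> s \<le> t \<Longrightarrow> t \<le> b \<Longrightarrow> (g has_integral f t - f s) {s..t}"
    and C: "C \<ge> 0" "\<And>l. l \<in> {a..b} \<Longrightarrow> \<bar>g l\<bar> \<le> C"
  shows "C-lipschitz_on {a..b} f"
proof (rule lipschitz_on_leI[OF _ C(1)])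
  fix s t assume "s \<in> {a..b}" "t \<in> {a..b}" and st: "s \<le> t"
  then have "norm (f t - f s) \<le> C * measure lborel {s..t}"
    using C by (intro has_integral_bound_real[OF _ _ I]) auto
  then show "dist (f s) (f t) \<le> C * dist s t" using st by (simp add: dist_real_def abs_minus_commute)
qed

lemma lipschitz_on_Icc_times:
  fixes f g :: "real \<Rightarrow> real"
  assumes f: "C-lipschitz_on {a..b} f" and g: "D-lipschitz_on {a..b} g"
  shows "\<exists>E. E-lipschitz_on {a..b} (\<lambda>x. f x * g x)"
proof -
  have "bounded (f ` {a..b})" "bounded (g ` {a..b})"
    by (intro compact_imp_bounded compact_continuous_image compact_Icc
        lipschitz_on_continuous_on[OF f] lipschitz_on_continuous_on[OF g])+
  then obtain A B where AB: "\<And>x. x \<in> {a..b} \<Longrightarrow> \<bar>f x\<bar> \<le> A" "\<And>x. x \<in> {a..b} \<Longrightarrow> \<bar>g x\<bar> \<le> B" "A > 0" "B > 0"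
    unfolding bounded_pos real_norm_def by (metis imageI)
  have "(A * D + B * C)-lipschitz_on {a..b} (\<lambda>x. f x * g x)"
  proof (rule lipschitz_onI)
    show "A * D + B * C \<ge> 0" using lipschitz_on_nonneg[OF f] lipschitz_on_nonneg[OF g] AB by simp
    fix x y assume xy: "x \<in> {a..b}" "y \<in> {a..b}"
    have "\<bar>f x * g x - f y * g y\<bar> = \<bar>f x * (g x - g y) + g y * (f x - f y)\<bar>" by (simp add: algebra_simps)
    also have "\<dots> \<le> \<bar>f x\<bar> * \<bar>g x - g y\<bar> + \<bar>g y\<bar> * \<bar>f x - f y\<bar>"
      by (rule order_trans[OF abs_triangle_ineq]) (simp add: abs_mult)
    also have "\<dots> \<le> A * (D * \<bar>x - y\<bar>) + B * (C * \<bar>x - y\<bar>)"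
      using lipschitz_onD[OF f xy] lipschitz_onD[OF g xy] AB xy
      by (intro add_mono mult_mono) (auto simp: dist_real_def)
    finally show "dist (f x * g x) (f y * g y) \<le> (A * D + B * C) * dist x y"
      by (simp add: dist_real_def algebra_simps)
  qed
  then show ?thesis by blast
qed

lemma integrable_on_bounded_borel:
  fixes f :: "real \<Rightarrow> real"
  assumes f: "f \<in> borel_measurable borel" and C: "\<And>l. l \<in> {a..b} \<Longrightarrow> \<bar>f l\<bar> \<le> C"
  shows "f integrable_on {a..b}"
proof (rule measurable_bounded_by_integrable_imp_integrable)
  show "f \<in> borel_measurable (lebesgue_on {a..b})"
    using f by (simp add: measurable_completion measurable_restrict_space1)
  show "(\<lambda>_. C) integrable_on {a..b}" by (rule integrable_const_ivl)
qed (use C in auto)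

lemma exp_has_integral:
  fixes c :: real assumes "s \<le> t"
  shows "((\<lambda>l. c * exp (c * l)) has_integral exp (c * t) - exp (c * s)) {s..t}"
  using assms
  by (intro fundamental_theorem_of_calculus)
     (auto intro!: derivative_eq_intros simp: has_real_derivative_iff_has_vector_derivative[symmetric])

lemma exp_lipschitz_on_Icc:
  fixes c :: real
  shows "(\<bar>c\<bar> * exp (\<bar>c\<bar> * (\<bar>a\<bar> + \<bar>b\<bar>)))-lipschitz_on {a..b} (\<lambda>l. exp (c * l))"
proof (rule has_integral_imp_lipschitz_on[OF exp_has_integral])
  fix l assume "l \<in> {a..b}"
  then have "\<bar>c * l\<bar> \<le> \<bar>c\<bar> * (\<bar>a\<bar> + \<bar>b\<bar>)"
    unfolding abs_mult by (intro mult_left_mono) auto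
  then have "c * l \<le> \<bar>c\<bar> * (\<bar>a\<bar> + \<bar>b\<bar>)" by linarith
  then show "\<bar>c * exp (c * l)\<bar> \<le> \<bar>c\<bar> * exp (\<bar>c\<bar> * (\<bar>a\<bar> + \<bar>b\<bar>))"
    by (simp add: abs_mult mult_left_mono)
qed auto

lemma exp_has_integral_atMost:
  fixes K :: real assumes K: "K > 0"
  shows "(\<lambda>l. exp (K * l)) absolutely_integrable_on {..t}" "integral {..t} (\<lambda>l. exp (K * l)) = exp (K * t) / K"
proof -
  have h: "((\<lambda>x. exp (- K * x)) has_integral exp (K * t) / K) {- t..}"
    using has_integral_exp_minus_to_infinity[OF K, of "- t"] by simp
  then have "(\<lambda>x. exp (- K * x)) absolutely_integrable_on {- t..}"
    by (intro nonnegative_absolutely_integrable_1) (auto simp: integrable_on_def)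
  moreover have "integral {- t..} (\<lambda>x. exp (- K * x)) = exp (K * t) / K"
    using h by (rule integral_unique)
  moreover have "uminus ` {- t..} \<subseteq> {..t}" "uminus ` {..t} \<subseteq> {- t..}" by auto
  ultimately have "(\<lambda>l. exp (K * l)) absolutely_integrable_on {..t} \<and> integral {..t} (\<lambda>l. exp (K * l)) = exp (K * t) / K"
    using has_absolute_integral_reflect_real[of "{- t..}" "{..t}" "\<lambda>l. exp (K * l)" "exp (K * t) / K"]
    by simp
  then show "(\<lambda>l. exp (K * l)) absolutely_integrable_on {..t}" "integral {..t} (\<lambda>l. exp (K * l)) = exp (K * t) / K"
    by auto
qed

text \<open>Variation of constants started at -infinity: y(t) is the integral of exp(-K (t - l))
  f(l) over l \<le> t, which converges since K > 0. In the proof \<open>J\<close> is this integral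
  without the factor exp(-K t).\<close>

lemma bounded_solution_linear_ode:
  fixes f :: "real \<Rightarrow> real"
  assumes K: "K > 0" and f[measurable]: "f \<in> borel_measurable borel" and C: "\<And>l. \<bar>f l\<bar> \<le> C"
  obtains y where "\<And>t. \<bar>y t\<bar> \<le> C / K" "continuous_on UNIV y"
    "\<And>s t. s \<le> t \<Longrightarrow> ((\<lambda>l. f l - K * y l) has_integral y t - y s) {s..t}"
proof -
  have C0: "C \<ge> 0" using C[of 0] by linarith
  define e where "e l = exp (K * l) * f l" for l
  have eb: "\<bar>e l\<bar> \<le> C * exp (K * l)" for l
    using C[of l] by (simp add: e_def abs_mult)
  have gint: "(\<lambda>l. C * exp (K * l)) integrable_on {..t}" for t
    using exp_has_integral_atMost(1)[OF K, of t]
    by (intro integrable_on_mult_right) (auto simp: absolutely_integrable_on_def)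
  have eint: "e integrable_on {..t}" for t
  proof (rule measurable_bounded_by_integrable_imp_integrable[OF _ gint])
    show "e \<in> borel_measurable (lebesgue_on {..t})"
      unfolding e_def by (intro measurable_restrict_space1 measurable_completion) simp
  qed (use eb in auto)
  define J where "J t = integral {..t} e" for t
  have J: "(e has_integral J t - J s) {s..t}" if "s \<le> t" for s t
  proof -
    have "e integrable_on {s..t}" using eint[of t] by (rule integrable_on_subinterval) auto
    then have 1: "(e has_integral integral {s..t} e) {s..t}" by (rule integrable_integral)
    have 2: "(e has_integral J s) {..s}" unfolding J_def using eint by (rule integrable_integral)
    have "{..s} \<inter> {s..t} = {s}" "{..s} \<union> {s..t} = {..t}" using that by auto
    with has_integral_Un[OF 2 1] have "(e has_integral J s + integral {s..t} e) {..t}" by simp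
    then have "J t = J s + integral {s..t} e" unfolding J_def by (rule integral_unique)
    with 1 show ?thesis by simp
  qed
  have Jb: "\<bar>J t\<bar> \<le> C * exp (K * t) / K" for t
  proof -
    have "norm (J t) \<le> integral {..t} (\<lambda>l. C * exp (K * l))"
      unfolding J_def using eint gint eb by (intro integral_norm_bound_integral) auto
    also have "\<dots> = C * (exp (K * t) / K)" using exp_has_integral_atMost(2)[OF K, of t] by simp
    finally show ?thesis by simp
  qed
  define y where "y t = exp (- K * t) * J t" for t
  have yb: "\<bar>y t\<bar> \<le> C / K" for t
  proof -
    have "\<bar>y t\<bar> = exp (- K * t) * \<bar>J t\<bar>" by (simp add: y_def abs_mult)
    also have "\<dots> \<le> exp (- K * t) * (C * exp (K * t) / K)" using Jb by (intro mult_left_mono) auto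
    also have "\<dots> = C / K" by (simp add: exp_minus)
    finally show ?thesis .
  qed
  have "\<exists>L. L-lipschitz_on {s..t} y" for s t
  proof -
    have "(C * exp (K * t))-lipschitz_on {s..t} J"
    proof (rule has_integral_imp_lipschitz_on[OF J])
      show "\<bar>e l\<bar> \<le> C * exp (K * t)" if "l \<in> {s..t}" for l
      proof -
        have "exp (K * l) \<le> exp (K * t)" using that K by simp
        then show ?thesis using eb[of l] C0 by (meson order_trans mult_left_mono)
      qed
    qed (use C0 in auto)
    then show ?thesis unfolding y_def using exp_lipschitz_on_Icc by (rule lipschitz_on_Icc_times[rotated])
  qed
  then have ylip: "abs_continuous_on {s..t} y" for s t using lipschitz_imp_abs_continuous_on by blast
  \<comment> \<open>The product rule is available only where \<open>J\<close> is differentiable;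
    absolute continuity of \<open>y\<close> then brings the equation back to integral form.\<close>
  have "AE t in lebesgue. (y has_real_derivative f t - K * y t) (at t)"
  proof (rule eventually_mono)
    show "AE t in lebesgue. (J has_real_derivative e t) (at t)"
      using J by (rule lebesgue_differentiation)
    fix t assume "(J has_real_derivative e t) (at t)"
    then have "(y has_real_derivative exp (- K * t) * e t + (- K * exp (- K * t)) * J t) (at t)"
      unfolding y_def by (auto intro!: derivative_eq_intros)
    moreover have "exp (- K * t) * e t = f t" by (simp add: e_def exp_minus)
    ultimately show "(y has_real_derivative f t - K * y t) (at t)"
      by (simp add: y_def algebra_simps)
  qed
  then have "((\<lambda>l. f l - K * y l) has_integral y t - y s) {s..t}" if "s \<le> t" for s t
    by (intro abs_continuous_has_integral[OF that ylip]) (auto intro: has_field_derivative_at_within elim!: eventually_mono)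
  moreover have "continuous_on UNIV y"
  proof -
    have "continuous_on {- real n<..<real n} y" for n
      by (rule continuous_on_subset[OF abs_continuous_on_imp_continuous_on[OF ylip[of "- real n" "real n"]]]) auto
    then have "continuous_on (\<Union>n::nat. {- real n<..<real n}) y"
      by (intro continuous_on_open_UN) auto
    moreover have "(\<Union>n::nat. {- real n<..<real n}) = UNIV"
    proof -
      have "\<exists>n. - real n < x \<and> x < real n" for x
        using reals_Archimedean2[of "\<bar>x\<bar>"] by (metis abs_less_iff minus_less_iff)
      then show ?thesis by auto
    qed
    ultimately show ?thesis by simp
  qed
  ultimately show ?thesis using that yb by blast
qed

section \<open>Integral solutions and lower functions\<close>

text \<open>The Caratheodory notion in integral form, which passes to pointwise limits and to
  reflections without mention of derivatives.\<close>

definition integral_solution :: "(real \<Rightarrow> real \<Rightarrow> real) \<Rightarrow> real set \<Rightarrow> (real \<Rightarrow> real) \<Rightarrow> bool" where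
  "integral_solution g J x \<longleftrightarrow>
    (\<forall>s\<in>J. \<forall>t\<in>J. s \<le> t \<longrightarrow> ((\<lambda>l. g l (x l)) has_integral x t - x s) {s..t})"

text \<open>Stated for increments and not for derivatives almost everywhere, because the latter
  would not exclude upward jumps. Downward jumps are compatible with it.\<close>

definition lower_function :: "(real \<Rightarrow> real \<Rightarrow> real) \<Rightarrow> real set \<Rightarrow> (real \<Rightarrow> real) \<Rightarrow> bool" where
  "lower_function g J b \<longleftrightarrow>
    (\<forall>s\<in>J. \<forall>t\<in>J. s \<le> t \<longrightarrow> (\<lambda>l. g l (b l)) integrable_on {s..t} \<and>
       b t - b s \<le> integral {s..t} (\<lambda>l. g l (b l)))"

lemma integral_solutionD:
  "integral_solution g J x \<Longrightarrow> s \<in> J \<Longrightarrow> t \<in> J \<Longrightarrow> s \<le> t \<Longrightarrow>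
    ((\<lambda>l. g l (x l)) has_integral x t - x s) {s..t}"
  by (simp add: integral_solution_def)

lemma lower_functionD:
  assumes "lower_function g J b" "s \<in> J" "t \<in> J" "s \<le> t"
  shows "(\<lambda>l. g l (b l)) integrable_on {s..t}" "b t - b s \<le> integral {s..t} (\<lambda>l. g l (b l))"
  using assms by (auto simp: lower_function_def)

lemma integral_solution_imp_lower_function:
  "integral_solution g J x \<Longrightarrow> lower_function g J x"
  unfolding integral_solution_def lower_function_def
  by (auto simp: has_integral_integrable_integral)

lemma caratheodory_imp_integral_solution:
  assumes "caratheodory_solution g I x"
  shows "integral_solution g I x"
  unfolding integral_solution_def
proof (intro ballI impI)
  fix s t assume st: "s \<in> I" "t \<in> I" "s \<le> t"
  have sub: "{s..t} \<subseteq> I"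
  proof
    fix l assume "l \<in> {s..t}"
    then show "l \<in> I" using assms st mem_is_interval_1_I[of I s t l] by (simp add: caratheodory_solution_def)
  qed
  show "((\<lambda>l. g l (x l)) has_integral x t - x s) {s..t}"
  proof (rule abs_continuous_has_integral[OF st(3)])
    show "abs_continuous_on {s..t} x" using assms sub by (auto simp: caratheodory_solution_def)
    have "AE l in lebesgue. l \<in> I \<longrightarrow> (x has_real_derivative g l (x l)) (at l within I)"
      using assms by (simp add: caratheodory_solution_def)
    then show "AE l in lebesgue. l \<in> {s..t} \<longrightarrow> (x has_real_derivative g l (x l)) (at l within {s..t})"
      by (rule eventually_mono) (use sub in \<open>auto intro: DERIV_subset\<close>)
  qed
qed

lemma integral_solution_imp_caratheodory:
  assumes x: "integral_solution g UNIV x" and L: "C-lipschitz_on UNIV x"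
  shows "caratheodory_solution g UNIV x"
  unfolding caratheodory_solution_def
proof (intro conjI allI impI)
  show "is_interval (UNIV :: real set)" by (rule is_interval_univ)
  show "abs_continuous_on {c..d} x" for c d
    using lipschitz_imp_abs_continuous_on lipschitz_on_subset[OF L] by blast
  have "AE t in lebesgue. (x has_real_derivative g t (x t)) (at t)"
    using integral_solutionD[OF x] by (intro lebesgue_differentiation) auto
  then show "AE t in lebesgue. t \<in> UNIV \<longrightarrow> (x has_real_derivative g t (x t)) (at t)" by simp
qed

section \<open>Comparison with linear decay and the maximal bounded solution\<close>

lemma integral_le_const:
  fixes h :: "real \<Rightarrow> real"
  assumes "h integrable_on {s..t}" "s \<le> t" "\<And>l. l \<in> {s..t} \<Longrightarrow> h l \<le> c"
  shows "integral {s..t} h \<le> c * (t - s)"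
proof -
  have "integral {s..t} h \<le> integral {s..t} (\<lambda>_. c)"
    using assms by (intro integral_le) (auto intro: integrable_const_ivl)
  then show ?thesis using assms(2) by (simp add: mult.commute)
qed

text \<open>If \<open>w\<close> were positive somewhere, it would grow by a fixed factor over a fixed backward time
  step, which is impossible near its supremum.\<close>

lemma bounded_decaying_nonpos:
  fixes w h :: "real \<Rightarrow> real"
  assumes K: "K > 0" and W: "\<And>t. \<bar>w t\<bar> \<le> W"
    and int: "\<And>s t. s \<le> t \<Longrightarrow> h integrable_on {s..t}"
    and inc: "\<And>s t. s \<le> t \<Longrightarrow> w t - w s \<le> integral {s..t} h"
    and le: "\<And>l. h l \<le> - K * w l"
  shows "w t \<le> 0"
proof (rule ccontr)
  assume "\<not> w t \<le> 0"
  then have wt: "w t > 0" by simp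
  define S where "S = Sup (range w)"
  have bdd: "bdd_above (range w)" "bdd_below (w ` A)" for A
    using W by (auto intro!: bdd_aboveI[of _ W] bdd_belowI[of _ "- W"] simp: abs_le_iff minus_le_iff)
  have wS: "w s \<le> S" for s unfolding S_def using bdd by (auto intro: cSup_upper)
  have S: "S > 0" using wS[of t] wt by simp
  have "2 / 3 * S < S" using S by simp
  then have "\<exists>z\<in>range w. 2 / 3 * S < z"
    unfolding S_def using less_cSup_iff[OF _ bdd(1)] by blast
  then obtain t' where t': "w t' > 2 / 3 * S" by blast
  \<comment> \<open>With K \<tau> = 1/2, going back by \<tau> multiplies \<open>w\<close> by at
    least 3/2, which lifts a value above 2/3 \<open>S\<close> beyond the supremum.\<close>
  define \<tau> where "\<tau> = 1 / (2 * K)"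
  have \<tau>: "\<tau> > 0" "K * \<tau> = 1 / 2" using K by (auto simp: \<tau>_def)
  have bw: "w s \<ge> w t' + K * m * (t' - s)"
    if s: "s \<in> {t' - \<tau>..t'}" and m: "\<And>l. l \<in> {t' - \<tau>..t'} \<Longrightarrow> w l \<ge> m" for s m
  proof -
    have "integral {s..t'} h \<le> (- K * m) * (t' - s)"
    proof (rule integral_le_const[OF int])
      fix l assume "l \<in> {s..t'}"
      then have "w l \<ge> m" using m s by auto
      then have "- K * w l \<le> - K * m" using K by simp
      then show "h l \<le> - K * m" using le[of l] by linarith
    qed (use s in auto)
    then show ?thesis using inc[of s t'] s by simp
  qed
  define m where "m = Inf (w ` {t' - \<tau>..t'})"
  have mw: "m \<le> w l" if "l \<in> {t' - \<tau>..t'}" for l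
    unfolding m_def using that bdd(2) by (auto intro: cInf_lower)
  \<comment> \<open>\<open>w\<close> may jump, so an argument with a first zero is not possible. A
    negative infimum \<open>m\<close> over the window would satisfy
    \<open>m \<ge> w t' + m / 2\<close>, which contradicts \<open>w t' > 0\<close>.\<close>
  have "m \<ge> 0"
  proof (rule ccontr)
    assume "\<not> m \<ge> 0"
    then have m: "m < 0" by simp
    have "w t' + m / 2 \<le> m"
      unfolding m_def
    proof (rule cInf_greatest)
      show "w ` {t' - \<tau>..t'} \<noteq> {}" using \<tau> by auto
      fix z assume "z \<in> w ` {t' - \<tau>..t'}"
      then obtain s where s: "s \<in> {t' - \<tau>..t'}" "z = w s" by auto
      have "K * (t' - s) \<le> K * \<tau>" using s K by (intro mult_left_mono) auto
      then have "K * (t' - s) \<le> 1 / 2" using \<tau>(2) by simp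
      then have "m * (K * (t' - s)) \<ge> m * (1 / 2)" using m by (intro mult_left_mono_neg) auto
      then show "w t' + Inf (w ` {t' - \<tau>..t'}) / 2 \<le> z"
        using bw[OF s(1) mw] s(2) by (simp add: m_def algebra_simps)
    qed
    then show False using m t' S by simp
  qed
  then have "w l \<ge> 0" if "l \<in> {t' - \<tau>..t'}" for l using mw[OF that] by simp
  then have "w l \<ge> w t'" if "l \<in> {t' - \<tau>..t'}" for l using bw[of l 0] that by simp
  from bw[of "t' - \<tau>", OF _ this] have "w (t' - \<tau>) \<ge> w t' + w t' * (K * \<tau>)"
    using \<tau> by (simp add: algebra_simps)
  then show False using t' wS[of "t' - \<tau>"] \<tau>(2) by simp
qed

text \<open>The slope -2 (y - \<Delta>) of the quadratic is at least -2 (R + D) for y \<le> R, and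
  the linear term compensates it. No lower bound on the arguments enters, so lower functions may be
  inserted freely.\<close>

lemma quad_rhs_mono_shifted:
  assumes "y \<le> z" "z \<le> R" "\<bar>\<Delta> l\<bar> \<le> D"
  shows "quad_rhs \<Delta> q l y + 2 * (R + D) * y \<le> quad_rhs \<Delta> q l z + 2 * (R + D) * z"
proof -
  have "(z - y) * (z + y - 2 * \<Delta> l) \<le> (z - y) * (2 * (R + D))"
    using assms by (intro mult_left_mono) auto
  then show ?thesis by (simp add: quad_rhs_def power2_eq_square algebra_simps)
qed

text \<open>Pointwise bounds and Borel measurability describe the situation after an essentially
  bounded coefficient has been replaced by a representative. The bounds are parameters so that the
  same \<open>D\<close> and \<open>B\<close> serve every step size \<open>h\<close>.\<close>

locale riccati =
  fixes \<Delta> q :: "real \<Rightarrow> real" and D B :: real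
  assumes \<Delta>_meas[measurable]: "\<Delta> \<in> borel_measurable borel"
    and q_meas[measurable]: "q \<in> borel_measurable borel"
    and \<Delta>_le: "\<And>t. \<bar>\<Delta> t\<bar> \<le> D" and q_le: "\<And>t. \<bar>q t\<bar> \<le> B"
begin

abbreviation "g \<equiv> quad_rhs \<Delta> q"

lemma D_nonneg: "D \<ge> 0" and B_nonneg: "B \<ge> 0"
  using \<Delta>_le[of 0] q_le[of 0] by linarith+

lemma quad_rhs_bound:
  assumes "\<bar>x\<bar> \<le> R"
  shows "\<bar>g l x\<bar> \<le> (R + D)\<^sup>2 + B"
proof -
  have "\<bar>x - \<Delta> l\<bar> \<le> R + D" using assms \<Delta>_le[of l] by linarith
  then have "(x - \<Delta> l)\<^sup>2 \<le> (R + D)\<^sup>2" by (metis abs_ge_zero power2_abs power_mono)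
  moreover have "(x - \<Delta> l)\<^sup>2 \<ge> 0" by simp
  ultimately show ?thesis using q_le[of l] unfolding quad_rhs_def by linarith
qed

lemma quad_rhs_meas[measurable]:
  assumes [measurable]: "x \<in> borel_measurable borel"
  shows "(\<lambda>l. g l (x l)) \<in> borel_measurable borel"
  unfolding quad_rhs_def by simp

text \<open>Since -z^2 \<le> -2 z + 1, the right-hand side lies below a linear decay of rate 2
  towards \<open>D + B + 1\<close>, and \<open>bounded_decaying_nonpos\<close> applies to the excess
  over that level.\<close>

lemma lower_function_le:
  assumes x: "lower_function g UNIV x" and R: "\<And>t. \<bar>x t\<bar> \<le> R"
  shows "x t \<le> D + B + 1"
proof -
  let ?M = "D + B + 1"
  have "x t - ?M \<le> 0"
  proof (rule bounded_decaying_nonpos[where w = "\<lambda>t. x t - ?M" and K = 2 and W = "R + \<bar>?M\<bar>" and h = "\<lambda>l. g l (x l)"])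
    fix l
    have "(x l - \<Delta> l - 1)\<^sup>2 \<ge> 0" by simp
    then have "- (x l - \<Delta> l)\<^sup>2 \<le> - 2 * (x l - \<Delta> l) + 1" by (simp add: power2_eq_square algebra_simps)
    then show "g l (x l) \<le> - 2 * (x l - ?M)"
      using \<Delta>_le[of l] q_le[of l] B_nonneg by (simp add: quad_rhs_def abs_le_iff)
  qed (use lower_functionD[OF x] R in \<open>auto intro: order_trans[OF abs_triangle_ineq4]\<close>)
  then show ?thesis by simp
qed

lemma bounded_solution_lipschitz:
  assumes x: "integral_solution g UNIV x" and R: "\<And>t. \<bar>x t\<bar> \<le> R"
  shows "((R + D)\<^sup>2 + B)-lipschitz_on UNIV x"
proof (rule lipschitz_onI)
  show nn: "0 \<le> (R + D)\<^sup>2 + B" using B_nonneg by simp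
  fix s t
  have "((R + D)\<^sup>2 + B)-lipschitz_on {min s t..max s t} x"
    by (rule has_integral_imp_lipschitz_on[OF integral_solutionD[OF x]])
       (use nn quad_rhs_bound[OF R] in auto)
  then show "dist (x s) (x t) \<le> ((R + D)\<^sup>2 + B) * dist s t"
    by (rule lipschitz_onD) auto
qed

lemma riccati_reflect: "riccati (\<lambda>t. - \<Delta> (- t)) (\<lambda>t. q (- t)) D B"
  by unfold_locales (auto simp: \<Delta>_le q_le)

text \<open>Adding \<open>K x\<close> with \<open>K = 2 (M + D)\<close> makes the right-hand side monotone below the upper bound \<open>M\<close>,
  so bounded solutions are fixed points of a monotone map \<open>T\<close> and the maximal one is the limit of
  its iterates from \<open>M\<close>.\<close>

theorem maximal_bounded_solution:
  assumes b: "lower_function g UNIV b" and Rb: "\<And>t. \<bar>b t\<bar> \<le> R"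
  obtains a where "integral_solution g UNIV a" "bounded (range a)"
    "\<And>x t. lower_function g UNIV x \<Longrightarrow> bounded (range x) \<Longrightarrow> x t \<le> a t"
proof -
  define M where "M = D + B + 1"
  define K where "K = 2 * (M + D)"
  have M: "M > 0" and K: "K > 0" using D_nonneg B_nonneg by (auto simp: M_def K_def)
  define LB where "LB x \<longleftrightarrow> lower_function g UNIV x \<and> bounded (range x)" for x
  have LBM: "x t \<le> M" if "LB x" for x t
  proof -
    obtain W where "\<And>t. \<bar>x t\<bar> \<le> W" using \<open>LB x\<close> by (auto simp: LB_def bounded_iff)
    then show ?thesis using lower_function_le[of x W] \<open>LB x\<close> by (auto simp: LB_def M_def)
  qed
  have LBb: "LB b" using b Rb by (auto simp: LB_def bounded_iff)
  define R' where "R' = R + M"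
  have R0: "R \<ge> 0" using Rb[of 0] by linarith
  \<comment> \<open>\<open>Q\<close> is the order interval in which the iteration lives: below
    \<open>M\<close> and above every bounded lower function. As \<open>b\<close> is one of these,
    members of \<open>Q\<close> are bounded by \<open>R'\<close>.\<close>
  define Q where "Q x \<longleftrightarrow> x \<in> borel_measurable borel \<and> (\<forall>t. x t \<le> M) \<and> (\<forall>z. LB z \<longrightarrow> (\<forall>t. z t \<le> x t))" for x
  have Qabs: "\<bar>x t\<bar> \<le> R'" if "Q x" for x t
  proof -
    have "b t \<le> x t" "x t \<le> M" using that LBb by (auto simp: Q_def)
    then show ?thesis using Rb[of t] R0 M by (auto simp: R'_def abs_le_iff)
  qed
  define f where "f x l = g l (x l) + K * x l" for x :: "real \<Rightarrow> real" and l
  have fb: "\<bar>f x l\<bar> \<le> (R' + D)\<^sup>2 + B + K * R'" if "Q x" for x l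
  proof -
    have "\<bar>K * x l\<bar> \<le> K * R'" using Qabs[OF that, of l] K by (simp add: abs_mult)
    then show ?thesis using quad_rhs_bound[OF Qabs[OF that, of l], of l]
      unfolding f_def by linarith
  qed
  have fmono: "f x l \<le> f y l" if "x l \<le> y l" "y l \<le> M" for x y l
    using quad_rhs_mono_shifted[of "x l" "y l" M \<Delta> l D q] that \<Delta>_le by (simp add: f_def K_def)
  \<comment> \<open>\<open>P x y\<close> says that \<open>y\<close> is a bounded continuous solution
    of y' + K y = g(x) + K x. The case y = x is the original equation.\<close>
  define P where "P x y \<longleftrightarrow> continuous_on UNIV y \<and> bounded (range y) \<and>
    (\<forall>s t. s \<le> t \<longrightarrow> ((\<lambda>l. f x l - K * y l) has_integral y t - y s) {s..t})" for x y
  have PD: "(\<lambda>l. f x l - K * y l) integrable_on {s..t}"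
      "integral {s..t} (\<lambda>l. f x l - K * y l) = y t - y s" if "P x y" "s \<le> t" for x y s t
    using that by (auto simp: P_def intro: integral_unique has_integral_integrable)
  define T where "T x = (SOME y. P x y)" for x
  have PT: "P x (T x)" if "Q x" for x
  proof -
    have [measurable]: "x \<in> borel_measurable borel" using that by (simp add: Q_def)
    have "f x \<in> borel_measurable borel" unfolding f_def by simp
    from bounded_solution_linear_ode[OF K this fb[OF that]] obtain y where
      "\<And>t. \<bar>y t\<bar> \<le> ((R' + D)\<^sup>2 + B + K * R') / K" "continuous_on UNIV y"
      "\<And>s t. s \<le> t \<Longrightarrow> ((\<lambda>l. f x l - K * y l) has_integral y t - y s) {s..t}" by blast
    then have "P x y" by (auto simp: P_def bounded_iff)
    then show ?thesis unfolding T_def by (rule someI[of "P x"])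
  qed
  \<comment> \<open>The difference \<open>z - y\<close> obeys the inequality of
    \<open>bounded_decaying_nonpos\<close>. This is used twice: to keep lower functions below
    \<open>T x\<close>, and for the monotonicity of \<open>T\<close>.\<close>
  have compare: "z t \<le> y t"
    if zb: "bounded (range z)" and y: "P x y"
      and zi: "\<And>s t. s \<le> t \<Longrightarrow> h integrable_on {s..t}" "\<And>s t. s \<le> t \<Longrightarrow> z t - z s \<le> integral {s..t} h"
      and h: "\<And>l. h l + K * z l \<le> f x l" for x y z h t
  proof -
    obtain W1 W2 where W: "\<And>t. \<bar>z t\<bar> \<le> W1" "\<And>t. \<bar>y t\<bar> \<le> W2"
      using zb y by (auto simp: bounded_iff P_def)
    have "z t - y t \<le> 0"
    proof (rule bounded_decaying_nonpos[OF K, where w = "\<lambda>t. z t - y t" and W = "W1 + W2" and h = "\<lambda>l. h l - (f x l - K * y l)"])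
      show "\<bar>z t - y t\<bar> \<le> W1 + W2" for t using W[of t] by linarith
      fix s t :: real assume st: "s \<le> t"
      then have yI: "((\<lambda>l. f x l - K * y l) has_integral y t - y s) {s..t}" using y by (simp add: P_def)
      show "(\<lambda>l. h l - (f x l - K * y l)) integrable_on {s..t}"
        by (rule integrable_diff[OF zi(1)[OF st] has_integral_integrable[OF yI]])
      have "integral {s..t} (\<lambda>l. h l - (f x l - K * y l)) = integral {s..t} h - (y t - y s)"
        using integral_diff[OF zi(1)[OF st] has_integral_integrable[OF yI]] integral_unique[OF yI] by simp
      then show "z t - y t - (z s - y s) \<le> integral {s..t} (\<lambda>l. h l - (f x l - K * y l))"
        using zi(2)[OF st] by simp
    next
      fix l show "h l - (f x l - K * y l) \<le> - K * (z l - y l)" using h[of l] by (simp add: algebra_simps)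
    qed
    then show ?thesis by simp
  qed
  have QT: "Q (T x)" if Qx: "Q x" for x
  proof -
    have p: "P x (T x)" using PT[OF Qx] .
    obtain W where W: "\<And>t. \<bar>T x t\<bar> \<le> W" using p by (auto simp: bounded_iff P_def)
    have "T x t - M \<le> 0" for t
    proof (rule bounded_decaying_nonpos[OF K, where w = "\<lambda>t. T x t - M" and W = "W + M" and h = "\<lambda>l. f x l - K * T x l"])
      show "\<bar>T x t - M\<bar> \<le> W + M" for t using W[of t] M by linarith
      fix l
      have "x l \<le> M" using Qx by (simp add: Q_def)
      then have "f x l \<le> f (\<lambda>_. M) l" by (intro fmono) auto
      \<comment> \<open>The constant \<open>M\<close> is an upper solution:
        \<open>M - \<Delta> l\<close> is at least \<open>1 + B\<close>, so its square outweighs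
        \<open>q l\<close>.\<close>
      also have "\<dots> \<le> K * M"
      proof -
        have "1 + B \<le> M - \<Delta> l" using \<Delta>_le[of l] by (auto simp: M_def abs_le_iff)
        then have "(1 + B)\<^sup>2 \<le> (M - \<Delta> l)\<^sup>2" using B_nonneg by (intro power_mono) auto
        moreover have "B \<le> (1 + B)\<^sup>2" using B_nonneg by (simp add: power2_eq_square algebra_simps)
        ultimately show ?thesis using q_le[of l] by (simp add: f_def quad_rhs_def abs_le_iff)
      qed
      finally show "f x l - K * T x l \<le> - K * (T x l - M)" by (simp add: algebra_simps)
    qed (use PD[OF p] in auto)
    moreover have "z t \<le> T x t" if z: "LB z" for z t
    proof (rule compare[OF _ p, where h = "\<lambda>l. g l (z l)"])
      show "g l (z l) + K * z l \<le> f x l" for l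
        using fmono[of z l x] Qx z by (simp add: Q_def f_def)
    qed (use z lower_functionD[of g UNIV z] in \<open>auto simp: LB_def\<close>)
    moreover have "T x \<in> borel_measurable borel"
      using p by (auto simp: P_def intro: borel_measurable_continuous_onI)
    ultimately show ?thesis by (auto simp: Q_def)
  qed
  have Tmono: "T x t \<le> T y t" if Qx: "Q x" and Qy: "Q y" and le: "\<And>l. x l \<le> y l" for x y t
  proof (rule compare[OF _ PT[OF Qy], where h = "\<lambda>l. f x l - K * T x l"])
    show "f x l - K * T x l + K * T x l \<le> f y l" for l
      using fmono[of x l y] le Qy by (simp add: Q_def)
  qed (use PT[OF Qx] PD[OF PT[OF Qx]] in \<open>auto simp: P_def\<close>)
  define X where "X n = (T ^^ n) (\<lambda>_. M)" for n
  have X0: "X 0 = (\<lambda>_. M)" and XS: "X (Suc n) = T (X n)" for n by (auto simp: X_def)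
  have QX: "Q (X n)" for n
  proof (induction n)
    case 0 show ?case unfolding X0 using LBM by (auto simp: Q_def)
  next
    case (Suc n) then show ?case unfolding XS by (rule QT)
  qed
  have Xdec: "X (Suc n) t \<le> X n t" for n t
  proof (induction n arbitrary: t)
    case 0 show ?case using QX[of 1] by (simp add: X0 Q_def)
  next
    case (Suc n) then show ?case unfolding XS[of "Suc n"] XS[of n]
      using Tmono[OF QX QX] by (metis XS)
  qed
  define a where "a t = (INF n. X n t)" for t
  have lim: "(\<lambda>n. X n t) \<longlonglongrightarrow> a t" for t
    unfolding a_def
  proof (rule LIMSEQ_decseq_INF)
    show "bdd_below (range (\<lambda>n. X n t))"
      using Qabs[OF QX, of _ t] by (auto intro!: bdd_belowI[of _ "- R'"] simp: abs_le_iff minus_le_iff)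
    show "decseq (\<lambda>n. X n t)" using Xdec by (intro decseq_SucI)
  qed
  have ab: "\<bar>a t\<bar> \<le> R'" for t
    using LIMSEQ_le_const2[OF tendsto_rabs[OF lim]] Qabs[OF QX] by blast
  \<comment> \<open>The iterates decrease to \<open>a\<close> pointwise and the bounds valid on
    \<open>Q\<close> dominate the integrands, so the identity for \<open>X (Suc k)\<close> passes to
    the limit, where the two terms \<open>K * a l\<close> cancel.\<close>
  have "integral_solution g UNIV a"
    unfolding integral_solution_def
  proof (intro ballI impI)
    fix s t :: real assume st: "s \<le> t"
    show "((\<lambda>l. g l (a l)) has_integral a t - a s) {s..t}"
    proof (rule has_integral_dominated_convergence)
      show "((\<lambda>l. f (X k) l - K * X (Suc k) l) has_integral X (Suc k) t - X (Suc k) s) {s..t}" for k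
        using PT[OF QX[of k]] st by (simp add: P_def XS)
      show "(\<lambda>_. (R' + D)\<^sup>2 + B + K * R' + K * R') integrable_on {s..t}" by (rule integrable_const_ivl)
      show "\<forall>l\<in>{s..t}. norm (f (X k) l - K * X (Suc k) l) \<le> (R' + D)\<^sup>2 + B + K * R' + K * R'" for k
      proof
        fix l
        have "\<bar>K * X (Suc k) l\<bar> \<le> K * R'" using Qabs[OF QX, of "Suc k" l] K by (simp add: abs_mult)
        then show "norm (f (X k) l - K * X (Suc k) l) \<le> (R' + D)\<^sup>2 + B + K * R' + K * R'"
          using fb[OF QX, of k l] by (simp del: abs_mult)
      qed
      show "\<forall>l\<in>{s..t}. (\<lambda>k. f (X k) l - K * X (Suc k) l) \<longlonglongrightarrow> g l (a l)"
      proof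
        fix l
        have "(\<lambda>k. f (X k) l - K * X (Suc k) l) \<longlonglongrightarrow> (g l (a l) + K * a l) - K * a l"
          unfolding f_def quad_rhs_def using lim LIMSEQ_Suc[OF lim] by (intro tendsto_intros)
        then show "(\<lambda>k. f (X k) l - K * X (Suc k) l) \<longlonglongrightarrow> g l (a l)" by simp
      qed
      show "(\<lambda>k. X (Suc k) t - X (Suc k) s) \<longlonglongrightarrow> a t - a s"
        by (intro tendsto_diff LIMSEQ_Suc lim)
    qed
  qed
  moreover have "bounded (range a)" using ab by (auto simp: bounded_iff)
  moreover have "x t \<le> a t" if "lower_function g UNIV x" "bounded (range x)" for x t
    using that QX by (intro LIMSEQ_le_const[OF lim]) (auto simp: Q_def LB_def)
  ultimately show ?thesis using that by blast
qed

end

section \<open>Attractor-repeller pairs from lower functions\<close>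

text \<open>Reversing time and sign together preserves the direction of the inequality; reversing
  only one of them would turn lower functions into upper ones.\<close>

lemma lower_function_reflect:
  assumes "lower_function g J b"
  shows "lower_function (\<lambda>t x. g (- t) (- x)) (uminus ` J) (\<lambda>t. - b (- t))"
  unfolding lower_function_def
proof (intro ballI impI conjI)
  fix s t assume "s \<in> uminus ` J" "t \<in> uminus ` J" "s \<le> t"
  then have st: "- t \<in> J" "- s \<in> J" "- t \<le> - s" by auto
  note L = lower_functionD[OF assms st]
  show "(\<lambda>l. g (- l) (- (- b (- l)))) integrable_on {s..t}"
    using L(1) Henstock_Kurzweil_Integration.integrable_reflect_real[of "\<lambda>l. g l (b l)" "- s" "- t"] by simp
  show "- b (- t) - - b (- s) \<le> integral {s..t} (\<lambda>l. g (- l) (- (- b (- l))))"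
    using L(2) Henstock_Kurzweil_Integration.integral_reflect_real[of "- s" "- t" "\<lambda>l. g l (b l)"] by simp
qed

lemma integral_solution_reflect:
  assumes "integral_solution g J x"
  shows "integral_solution (\<lambda>t x. g (- t) (- x)) (uminus ` J) (\<lambda>t. - x (- t))"
  unfolding integral_solution_def
proof (intro ballI impI)
  fix s t assume "s \<in> uminus ` J" "t \<in> uminus ` J" "s \<le> t"
  then have st: "- t \<in> J" "- s \<in> J" "- t \<le> - s" by auto
  show "((\<lambda>l. g (- l) (- (- x (- l)))) has_integral - x (- t) - - x (- s)) {s..t}"
    using has_integral_reflect_lemma_real[OF integral_solutionD[OF assms st]] by simp
qed

lemma quad_rhs_reflect:
  "(\<lambda>t x. quad_rhs \<Delta> q (- t) (- x)) = quad_rhs (\<lambda>t. - \<Delta> (- t)) (\<lambda>t. q (- t))"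
  by (auto simp: quad_rhs_def fun_eq_iff power2_eq_square algebra_simps)

lemma bounded_range_reflect: "bounded (range x) \<Longrightarrow> bounded (range (\<lambda>t. - x (- t :: real) :: real))"
  by (auto simp: bounded_iff)

section \<open>Hyperbolicity estimates and uniform separation\<close>

lemma interval_integral_lebesgue_eq:
  fixes f :: "real \<Rightarrow> real"
  assumes f: "f \<in> borel_measurable borel" and C: "\<And>l. \<bar>f l\<bar> \<le> C" and st: "s \<le> t"
    and i: "(f has_integral i) {s..t}"
  shows "(LINT l=ereal s..ereal t|lebesgue. f l) = i"
proof -
  have "f absolutely_integrable_on {s<..<t}"
  proof (rule measurable_bounded_by_integrable_imp_absolutely_integrable)
    show "f \<in> borel_measurable (lebesgue_on {s<..<t})"
      using f by (simp add: measurable_completion measurable_restrict_space1)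
    show "(\<lambda>_. C) integrable_on {s<..<t}"
      using integrable_on_open_interval_real[of "\<lambda>_. C" s t] by (simp add: integrable_const_ivl)
  qed (use C in auto)
  then show ?thesis
    using st set_lebesgue_integral_eq_integral(2)[of "{s<..<t}" f] integral_open_interval_real[of s t f] integral_unique[OF i]
    by (simp add: interval_lebesgue_integral_def)
qed

lemma interval_integral_reverse:
  fixes f :: "real \<Rightarrow> real"
  shows "(LINT l=ereal s..ereal t|M. f l) = - (LINT l=ereal t..ereal s|M. f l)"
  by (cases s t rule: linorder_cases) (auto simp: interval_lebesgue_integral_def set_lebesgue_integral_def)

context riccati begin

lemma AE_derivative:
  assumes "integral_solution g UNIV x"
  shows "AE t in lebesgue. (x has_real_derivative g t (x t)) (at t)"
  using integral_solutionD[OF assms] by (intro lebesgue_differentiation) auto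

lemma solution_meas:
  assumes "integral_solution g UNIV x" "\<And>t. \<bar>x t\<bar> \<le> R"
  shows "x \<in> borel_measurable borel"
  using lipschitz_on_continuous_on[OF bounded_solution_lipschitz[OF assms]]
  by (rule borel_measurable_continuous_onI)

text \<open>The difference of two solutions satisfies u' = -(a + r - 2 \<Delta>) u. The lower bound
  \<kappa> keeps its values where \<open>ln\<close> is Lipschitz with constant 1 / \<kappa>, so ln u
  is absolutely continuous and its derivative can be integrated.\<close>

lemma log_difference:
  assumes a: "integral_solution g UNIV a" "\<And>t. \<bar>a t\<bar> \<le> R"
    and r: "integral_solution g UNIV r" "\<And>t. \<bar>r t\<bar> \<le> R"
    and \<kappa>: "\<kappa> > 0" "\<And>t. \<kappa> \<le> a t - r t" and st: "s \<le> t"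
  shows "((\<lambda>l. - (a l + r l - 2 * \<Delta> l)) has_integral ln (a t - r t) - ln (a s - r s)) {s..t}"
proof (rule abs_continuous_has_integral[OF st])
  let ?L = "(R + D)\<^sup>2 + B"
  have lip: "(?L + ?L)-lipschitz_on {s..t} (\<lambda>l. a l - r l)"
    using bounded_solution_lipschitz[OF a] bounded_solution_lipschitz[OF r]
    by (intro lipschitz_on_diff) (auto intro: lipschitz_on_subset)
  have "(inverse \<kappa>)-lipschitz_on {\<kappa>..} ln"
  proof (rule lipschitz_onI)
    fix x y assume "x \<in> {\<kappa>..}" "y \<in> {\<kappa>..}"
    then have xy: "\<kappa> \<le> x" "\<kappa> \<le> y" by auto
    have *: "ln y - ln x \<le> inverse \<kappa> * (y - x)" if "\<kappa> \<le> x" "x \<le> y" for x y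
    proof -
      have "ln y - ln x \<le> (y - x) / x" using that \<kappa>(1) by (intro ln_diff_le) auto
      also have "\<dots> \<le> inverse \<kappa> * (y - x)"
        using that \<kappa>(1) by (simp add: divide_inverse_commute mult_right_mono le_imp_inverse_le)
      finally show ?thesis .
    qed
    show "dist (ln x) (ln y) \<le> inverse \<kappa> * dist x y"
      using *[of x y] *[of y x] xy \<kappa>(1) by (cases "x \<le> y") (auto simp: dist_real_def abs_if)
  qed (use \<kappa> in simp)
  then have "(inverse \<kappa>)-lipschitz_on ((\<lambda>l. a l - r l) ` {s..t}) ln"
    by (rule lipschitz_on_subset) (use \<kappa> in auto)
  from lipschitz_on_compose2[OF lip this]
  show "abs_continuous_on {s..t} (\<lambda>l. ln (a l - r l))"
    by (intro lipschitz_imp_abs_continuous_on)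
  show "AE l in lebesgue. l \<in> {s..t} \<longrightarrow>
      ((\<lambda>l. ln (a l - r l)) has_real_derivative - (a l + r l - 2 * \<Delta> l)) (at l within {s..t})"
    using AE_derivative[OF a(1)] AE_derivative[OF r(1)]
  proof eventually_elim
    case (elim l)
    have pos: "a l - r l > 0" using \<kappa>(1) \<kappa>(2)[of l] by linarith
    have "((\<lambda>l. ln (a l - r l)) has_real_derivative (g l (a l) - g l (r l)) / (a l - r l)) (at l)"
      using elim pos by (auto intro!: derivative_eq_intros)
    moreover have "g l (a l) - g l (r l) = (a l - r l) * - (a l + r l - 2 * \<Delta> l)"
      by (simp add: quad_rhs_def power2_eq_square algebra_simps)
    ultimately show ?case using pos by (auto intro: has_field_derivative_at_within)
  qed
qed

text \<open>The logarithm of a - r stays between ln \<kappa> and ln U with U = 2 R, and the integral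
  of a - r grows at least like \<kappa> (t - s). The two exponents are sums of these terms, which
  gives the hyperbolicity constants k = U / \<kappa> and \<beta> = \<kappa>.\<close>

lemma separated_imp_pair:
  assumes a: "integral_solution g UNIV a" "\<And>t. \<bar>a t\<bar> \<le> R"
    and r: "integral_solution g UNIV r" "\<And>t. \<bar>r t\<bar> \<le> R"
    and \<kappa>: "\<kappa> > 0" "\<And>t. \<kappa> \<le> a t - r t"
    and between: "\<And>x t. integral_solution g UNIV x \<Longrightarrow> bounded (range x) \<Longrightarrow> r t \<le> x t \<and> x t \<le> a t"
  shows "attractor_repeller_pair \<Delta> q a r"
proof -
  note [measurable] = solution_meas[OF a] solution_meas[OF r]
  have sol: "bounded_solution g x" if "integral_solution g UNIV x" "\<And>t. \<bar>x t\<bar> \<le> R" for x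
    using integral_solution_imp_caratheodory[OF that(1) bounded_solution_lipschitz[OF that]] that(2)
    by (auto simp: bounded_solution_def bounded_iff)
  define U where "U = 2 * R"
  have U: "a t - r t \<le> U" for t using a(2)[of t] r(2)[of t] by (auto simp: U_def)
  have \<kappa>U: "\<kappa> \<le> U" using \<kappa>(2)[of 0] U[of 0] by linarith
  have lnb: "ln (a t - r t) \<le> ln U" "ln \<kappa> \<le> ln (a t - r t)" for t
  proof -
    have "0 < a t - r t" using \<kappa>(1) \<kappa>(2)[of t] by linarith
    then show "ln (a t - r t) \<le> ln U" "ln \<kappa> \<le> ln (a t - r t)"
      using U[of t] \<kappa>(1) \<kappa>(2)[of t] by auto
  qed
  have uI: "\<exists>i. ((\<lambda>l. a l - r l) has_integral i) {s..t} \<and> \<kappa> * (t - s) \<le> i" if st: "s \<le> t" for s t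
  proof -
    have int: "(\<lambda>l. a l - r l) integrable_on {s..t}"
    proof (rule integrable_on_bounded_borel)
      show "\<bar>a l - r l\<bar> \<le> U" for l
        using U[of l] \<kappa>(1) \<kappa>(2)[of l] by simp
    qed simp
    have "integral {s..t} (\<lambda>_. \<kappa>) \<le> integral {s..t} (\<lambda>l. a l - r l)"
      using int \<kappa>(2) by (intro integral_le) (auto intro: integrable_const_ivl)
    then show ?thesis using int st by (intro exI[of _ "integral {s..t} (\<lambda>l. a l - r l)"]) (auto simp: mult.commute)
  qed
  have lin: "\<bar>- 2 * (y - \<Delta> l)\<bar> \<le> 2 * (R + D)" if "\<bar>y\<bar> \<le> R" for y l
  proof -
    have "\<bar>y - \<Delta> l\<bar> \<le> R + D" using that \<Delta>_le[of l] by linarith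
    then show ?thesis by (simp only: abs_mult) simp
  qed
  have linA: "\<bar>- 2 * (a l - \<Delta> l)\<bar> \<le> 2 * (R + D)" and linR: "\<bar>- 2 * (r l - \<Delta> l)\<bar> \<le> 2 * (R + D)" for l
    using lin a(2) r(2) by auto
  have A: "(LINT l=ereal s..ereal t|lebesgue. (- 2 * (a l - \<Delta> l))) \<le> ln U - ln \<kappa> - \<kappa> * (t - s)"
    if st: "s \<le> t" for s t
  proof -
    obtain i where i: "((\<lambda>l. a l - r l) has_integral i) {s..t}" "\<kappa> * (t - s) \<le> i" using uI[OF st] by blast
    have "((\<lambda>l. - (a l + r l - 2 * \<Delta> l) - (a l - r l)) has_integral
        ln (a t - r t) - ln (a s - r s) - i) {s..t}"
      by (rule has_integral_diff[OF log_difference[OF a r \<kappa> st] i(1)])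
    then have "((\<lambda>l. - 2 * (a l - \<Delta> l)) has_integral ln (a t - r t) - ln (a s - r s) - i) {s..t}"
      by (simp add: algebra_simps)
    from interval_integral_lebesgue_eq[OF _ linA st this]
    have "(LINT l=ereal s..ereal t|lebesgue. (- 2 * (a l - \<Delta> l))) = ln (a t - r t) - ln (a s - r s) - i" by simp
    then show ?thesis using i(2) lnb[of t] lnb[of s] by linarith
  qed
  have Rp: "(LINT l=ereal s..ereal t|lebesgue. (- 2 * (r l - \<Delta> l))) \<le> ln U - ln \<kappa> + \<kappa> * (t - s)"
    if ts: "t \<le> s" for s t
  proof -
    obtain i where i: "((\<lambda>l. a l - r l) has_integral i) {t..s}" "\<kappa> * (s - t) \<le> i" using uI[OF ts] by blast
    have "((\<lambda>l. - (a l + r l - 2 * \<Delta> l) + (a l - r l)) has_integral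
        ln (a s - r s) - ln (a t - r t) + i) {t..s}"
      by (rule has_integral_add[OF log_difference[OF a r \<kappa> ts] i(1)])
    then have "((\<lambda>l. - 2 * (r l - \<Delta> l)) has_integral ln (a s - r s) - ln (a t - r t) + i) {t..s}"
      by (simp add: algebra_simps)
    from interval_integral_lebesgue_eq[OF _ linR ts this]
    have "(LINT l=ereal t..ereal s|lebesgue. (- 2 * (r l - \<Delta> l))) = ln (a s - r s) - ln (a t - r t) + i" by simp
    moreover have "(LINT l=ereal s..ereal t|lebesgue. (- 2 * (r l - \<Delta> l))) =
        - (LINT l=ereal t..ereal s|lebesgue. (- 2 * (r l - \<Delta> l)))"
      by (rule interval_integral_reverse)
    moreover have "\<kappa> * (t - s) = - (\<kappa> * (s - t))" by (simp add: algebra_simps)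
    ultimately show ?thesis using i(2) lnb[of t] lnb[of s] by linarith
  qed
  have expk: "exp y \<le> U / \<kappa> * exp z" if "y \<le> ln U - ln \<kappa> + z" for y z
  proof -
    have "exp y \<le> exp (ln U - ln \<kappa> + z)" using that by simp
    also have "\<dots> = U / \<kappa> * exp z" using \<kappa>(1) \<kappa>U by (simp add: exp_add exp_diff)
    finally show ?thesis .
  qed
  have "\<exists>k\<ge>1. \<exists>\<beta>>0.
     (\<forall>s t. s \<le> t \<longrightarrow> exp (LINT l=ereal s..ereal t|lebesgue. (- 2 * (a l - \<Delta> l))) \<le> k * exp (- \<beta> * (t - s))) \<and>
     (\<forall>s t. t \<le> s \<longrightarrow> exp (LINT l=ereal s..ereal t|lebesgue. (- 2 * (r l - \<Delta> l))) \<le> k * exp (\<beta> * (t - s)))"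
  proof (rule exI[of _ "U / \<kappa>"], rule conjI, goal_cases)
    case 1 show ?case using \<kappa>U \<kappa>(1) by simp
  next
    case 2 show ?case
    proof (rule exI[of _ \<kappa>], intro conjI allI impI)
      show "exp (LINT l=ereal s..ereal t|lebesgue. (- 2 * (a l - \<Delta> l))) \<le> U / \<kappa> * exp (- \<kappa> * (t - s))"
        if "s \<le> t" for s t using A[OF that] by (intro expk) simp
      show "exp (LINT l=ereal s..ereal t|lebesgue. (- 2 * (r l - \<Delta> l))) \<le> U / \<kappa> * exp (\<kappa> * (t - s))"
        if "t \<le> s" for s t using Rp[OF that] by (intro expk) simp
    qed (rule \<kappa>(1))
  qed
  moreover have "r t \<le> x t \<and> x t \<le> a t" if "bounded_solution g x" for x t
    using between[OF caratheodory_imp_integral_solution] that by (auto simp: bounded_solution_def)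
  ultimately show ?thesis
    unfolding attractor_repeller_pair_def using sol[OF a] sol[OF r] by blast
qed

text \<open>A single lower function \<open>b\<close> would give only r \<le> b \<le> a, which allows
  a and r to touch. The copy shifted up pushes the maximal bounded solution away from
  \<open>b\<close>, the copy shifted down pushes the minimal one away, and a gap remains.\<close>

theorem lower_functions_imp_pair:
  assumes \<kappa>: "\<kappa> > 0" and Rb: "\<And>t. \<bar>b t\<bar> \<le> R"
    and up: "lower_function g UNIV (\<lambda>t. b t + \<kappa>)"
    and down: "lower_function g UNIV (\<lambda>t. b t - \<kappa>)"
  shows "has_attractor_repeller_pair \<Delta> q"
proof -
  have Rk: "\<bar>b t + \<kappa>\<bar> \<le> R + \<kappa>" "\<bar>- (b t - \<kappa>)\<bar> \<le> R + \<kappa>" for t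
    using Rb[of t] \<kappa> by linarith+
  obtain a where a: "integral_solution g UNIV a" "bounded (range a)"
    "\<And>x t. lower_function g UNIV x \<Longrightarrow> bounded (range x) \<Longrightarrow> x t \<le> a t"
    using maximal_bounded_solution[OF up Rk(1)] by blast
  interpret refl: riccati "\<lambda>t. - \<Delta> (- t)" "\<lambda>t. q (- t)" D B by (rule riccati_reflect)
  have down': "lower_function refl.g UNIV (\<lambda>t. - (b (- t) - \<kappa>))"
    using lower_function_reflect[OF down] by (simp add: quad_rhs_reflect surj_uminus)
  obtain c where c: "integral_solution refl.g UNIV c" "bounded (range c)"
    "\<And>x t. lower_function refl.g UNIV x \<Longrightarrow> bounded (range x) \<Longrightarrow> x t \<le> c t"
    using refl.maximal_bounded_solution[OF down' Rk(2)] by blast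
  define r where "r t = - c (- t)" for t
  have r: "integral_solution g UNIV r"
    using integral_solution_reflect[OF c(1)] unfolding quad_rhs_reflect surj_uminus r_def by simp
  obtain Ra Rc where "\<And>t. \<bar>a t\<bar> \<le> Ra" "\<And>t. \<bar>c t\<bar> \<le> Rc"
    using a(2) c(2) by (auto simp: bounded_iff)
  then have bd: "\<bar>a t\<bar> \<le> max Ra Rc" "\<bar>r t\<bar> \<le> max Ra Rc" for t
    by (auto simp: r_def le_max_iff_disj)
  have bb: "bounded (range (\<lambda>t. b t + \<kappa>))" "bounded (range (\<lambda>t. - (b (- t) - \<kappa>)))"
    using Rk by (auto simp: bounded_iff)
  have "attractor_repeller_pair \<Delta> q a r"
  proof (rule separated_imp_pair[OF a(1) bd(1) r bd(2) \<kappa>])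
    fix t
    have "b t + \<kappa> \<le> a t" "- (b (- (- t)) - \<kappa>) \<le> c (- t)"
      using a(3)[OF up bb(1)] c(3)[OF down' bb(2)] .
    then show "\<kappa> \<le> a t - r t" using \<kappa> by (simp add: r_def)
  next
    fix x t assume x: "integral_solution g UNIV x" "bounded (range x)"
    have "integral_solution refl.g UNIV (\<lambda>t. - x (- t))"
      using integral_solution_reflect[OF x(1)] by (simp add: quad_rhs_reflect surj_uminus)
    from c(3)[OF integral_solution_imp_lower_function[OF this] bounded_range_reflect[OF x(2)], of "- t"]
    have "r t \<le> x t" by (simp add: r_def)
    moreover have "x t \<le> a t" by (rule a(3)[OF integral_solution_imp_lower_function[OF x(1)] x(2)])
    ultimately show "r t \<le> x t \<and> x t \<le> a t" by simp
  qed
  then show ?thesis by (auto simp: has_attractor_repeller_pair_def)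
qed

text \<open>Adding the two hyperbolicity estimates bounds the integral of \<open>a - r\<close> over a long interval
  from below, while \<open>a - r\<close> grows at most exponentially.\<close>

lemma pair_imp_separated:
  assumes "attractor_repeller_pair \<Delta> q a r"
  obtains \<kappa> where "\<kappa> > 0" "\<And>t. \<kappa> \<le> a t - r t"
proof -
  define HA where "HA k \<beta> \<longleftrightarrow> (\<forall>s t. s \<le> t \<longrightarrow>
      exp (LINT l=ereal s..ereal t|lebesgue. (- 2 * (a l - \<Delta> l))) \<le> k * exp (- \<beta> * (t - s)))" for k \<beta>
  define HR where "HR k \<beta> \<longleftrightarrow> (\<forall>s t. t \<le> s \<longrightarrow>
      exp (LINT l=ereal s..ereal t|lebesgue. (- 2 * (r l - \<Delta> l))) \<le> k * exp (\<beta> * (t - s)))" for k \<beta>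
  note pair = assms[unfolded attractor_repeller_pair_def, folded HA_def HR_def]
  then obtain k \<beta> where k: "k \<ge> 1" "\<beta> > 0" and H: "HA k \<beta>" "HR k \<beta>" by blast
  note ka = H(1)[unfolded HA_def, rule_format] and kr = H(2)[unfolded HR_def, rule_format]
  from pair have ba: "bounded_solution g a" and br: "bounded_solution g r" by simp_all
  with pair have le: "r t \<le> a t" for t by blast
  have a: "integral_solution g UNIV a" and r: "integral_solution g UNIV r"
    using ba br by (auto simp: bounded_solution_def intro: caratheodory_imp_integral_solution)
  obtain R1 R2 where R12: "\<And>t. \<bar>a t\<bar> \<le> R1" "\<And>t. \<bar>r t\<bar> \<le> R2"
    using ba br by (auto simp: bounded_solution_def bounded_iff)
  define R where "R = max R1 R2"
  have Ra: "\<bar>a t\<bar> \<le> R" and Rr: "\<bar>r t\<bar> \<le> R" for t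
    using R12[of t] by (auto simp: R_def)
  note [measurable] = solution_meas[OF a Ra] solution_meas[OF r Rr]
  define c where "c = 2 * (R + D)"
  have R0: "R \<ge> 0" using Ra[of 0] by linarith
  have lin: "\<bar>- 2 * (y - \<Delta> l)\<bar> \<le> c" if "\<bar>y\<bar> \<le> R" for y l
  proof -
    have "\<bar>y - \<Delta> l\<bar> \<le> R + D" using that \<Delta>_le[of l] by linarith
    then show ?thesis unfolding c_def by (simp only: abs_mult) simp
  qed
  have linA: "\<bar>- 2 * (a l - \<Delta> l)\<bar> \<le> c" and linR: "\<bar>- 2 * (r l - \<Delta> l)\<bar> \<le> c" for l
    using lin Ra Rr by auto
  define u where "u l = a l - r l" for l
  have growth: "u t \<le> u s * exp (c * (t - s))" if st: "s \<le> t" for s t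
  proof -
    let ?h = "\<lambda>l. exp (- c * l) * (g l (a l) - g l (r l) - c * u l)"
    have "(((R + D)\<^sup>2 + B) + ((R + D)\<^sup>2 + B))-lipschitz_on {s..t} u"
      unfolding u_def using bounded_solution_lipschitz[OF a Ra] bounded_solution_lipschitz[OF r Rr]
      by (intro lipschitz_on_diff) (auto intro: lipschitz_on_subset)
    from lipschitz_on_Icc_times[OF exp_lipschitz_on_Icc this]
    have ac: "abs_continuous_on {s..t} (\<lambda>l. exp (- c * l) * u l)"
      using lipschitz_imp_abs_continuous_on by blast
    have hI: "(?h has_integral exp (- c * t) * u t - exp (- c * s) * u s) {s..t}"
    proof (rule abs_continuous_has_integral[OF st ac])
      show "AE l in lebesgue. l \<in> {s..t} \<longrightarrow>
          ((\<lambda>l. exp (- c * l) * u l) has_real_derivative ?h l) (at l within {s..t})"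
        using AE_derivative[OF a] AE_derivative[OF r]
      proof eventually_elim
        case (elim l)
        have "((\<lambda>l. exp (- c * l) * u l) has_real_derivative
            exp (- c * l) * (g l (a l) - g l (r l)) + (- c * exp (- c * l)) * u l) (at l)"
          unfolding u_def using elim by (auto intro!: derivative_eq_intros)
        then show ?case by (auto intro: has_field_derivative_at_within simp: algebra_simps)
      qed
    qed
    have "?h l \<le> 0" for l
    proof -
      have "- (a l + r l - 2 * \<Delta> l) \<le> c" using Ra[of l] Rr[of l] \<Delta>_le[of l] unfolding c_def by (simp add: abs_le_iff)
      then have "u l * - (a l + r l - 2 * \<Delta> l) \<le> u l * c" using le[of l] by (intro mult_left_mono) (auto simp: u_def)
      moreover have "g l (a l) - g l (r l) = u l * - (a l + r l - 2 * \<Delta> l)"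
        by (simp add: u_def quad_rhs_def power2_eq_square algebra_simps)
      ultimately show ?thesis by (simp add: mult_le_0_iff mult.commute)
    qed
    then have "exp (- c * t) * u t - exp (- c * s) * u s \<le> 0"
      by (rule has_integral_le[OF hI has_integral_0])
    then have "exp (c * t) * (exp (- c * t) * u t) \<le> exp (c * t) * (exp (- c * s) * u s)"
      by (intro mult_left_mono) auto
    moreover have "exp (c * t) * (exp (- c * t) * u t) = u t" by (simp add: exp_minus)
    moreover have "exp (c * t) * (exp (- c * s) * u s) = u s * exp (c * (t - s))"
      by (simp add: exp_minus exp_diff right_diff_distrib divide_inverse)
    ultimately show ?thesis by (simp only:)
  qed
  \<comment> \<open>This length makes k exp(-\<beta> len) = exp(-1). Each hyperbolicity estimate
    then yields an integral of at most -1 over the window, and their sum forces the integral of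
    \<open>u\<close> to be at least 1.\<close>
  define len where "len = (ln k + 1) / \<beta>"
  have len: "len > 0" "\<beta> * len = ln k + 1" using k by (auto simp: len_def add_nonneg_pos)
  have "exp (- c * len) / len \<le> a s - r s" for s
  proof -
    let ?t = "s + len"
    have st: "s \<le> ?t" using len by simp
    have ia: "(\<lambda>l. - 2 * (a l - \<Delta> l)) integrable_on {s..?t}" "(\<lambda>l. - 2 * (r l - \<Delta> l)) integrable_on {s..?t}"
      using linA linR by (auto intro!: integrable_on_bounded_borel)
    let ?ia = "integral {s..?t} (\<lambda>l. - 2 * (a l - \<Delta> l))" and ?ir = "integral {s..?t} (\<lambda>l. - 2 * (r l - \<Delta> l))"
    have La: "(LINT l=ereal s..ereal ?t|lebesgue. (- 2 * (a l - \<Delta> l))) = ?ia"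
      using interval_integral_lebesgue_eq[OF _ linA st integrable_integral[OF ia(1)]] by simp
    have "(LINT l=ereal s..ereal ?t|lebesgue. (- 2 * (r l - \<Delta> l))) = ?ir"
      using interval_integral_lebesgue_eq[OF _ linR st integrable_integral[OF ia(2)]] by simp
    then have Lr: "(LINT l=ereal ?t..ereal s|lebesgue. (- 2 * (r l - \<Delta> l))) = - ?ir"
      using interval_integral_reverse[of lebesgue ?t s] by metis
    have e: "k * exp (- (\<beta> * len)) = exp (- 1)" using k len(2) by (simp add: exp_add exp_minus exp_diff inverse_eq_divide)
    have "exp ?ia \<le> exp (- 1)" "exp (- ?ir) \<le> exp (- 1)"
      using ka[OF st] kr[OF st] La Lr e by simp_all
    then have i1: "?ia - ?ir \<le> - 2" by simp
    have "?ia - ?ir = integral {s..?t} (\<lambda>l. - 2 * u l)"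
      unfolding integral_diff[OF ia, symmetric] by (simp add: u_def algebra_simps)
    then have "integral {s..?t} u \<ge> 1" using i1 by simp
    moreover have "u integrable_on {s..?t}"
    proof -
      have "(\<lambda>l. - 2 * u l) integrable_on {s..?t}"
        using integrable_diff[OF ia] by (simp add: u_def algebra_simps)
      from integrable_on_mult_right[OF this, of "- 1 / 2"] show ?thesis by simp
    qed
    \<comment> \<open>With total mass at least 1 on the window and limited growth from
      \<open>s\<close>, the starting value \<open>u s\<close> cannot be small.\<close>
    moreover have "u l \<le> u s * exp (c * len)" if "l \<in> {s..?t}" for l
    proof -
      have "u l \<le> u s * exp (c * (l - s))" using that by (intro growth) auto
      also have "\<dots> \<le> u s * exp (c * len)"
        using that le[of s] R0 D_nonneg by (intro mult_left_mono) (auto simp: u_def c_def intro!: mult_left_mono)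
      finally show ?thesis .
    qed
    ultimately have "1 \<le> u s * exp (c * len) * len"
      using integral_le_const[of u s ?t "u s * exp (c * len)"] st by simp
    then have "exp (- c * len) * 1 \<le> exp (- c * len) * (u s * exp (c * len) * len)" by (intro mult_left_mono) auto
    also have "\<dots> = u s * len" by (simp add: exp_minus)
    finally show ?thesis using len(1) by (simp add: u_def divide_le_eq)
  qed
  then show ?thesis using that[of "exp (- c * len) / len"] len by simp
qed

end

section \<open>Strict lower functions\<close>

lemma lower_functionI:
  assumes J: "is_interval J"
    and int: "\<And>s t. s \<in> J \<Longrightarrow> t \<in> J \<Longrightarrow> s \<le> t \<Longrightarrow> (\<lambda>l. g l (b l)) integrable_on {s..t}"
    and h: "\<And>s t. s \<in> J \<Longrightarrow> t \<in> J \<Longrightarrow> s \<le> t \<Longrightarrow> (h has_integral b t - b s) {s..t}"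
    and le: "\<And>l. l \<in> J \<Longrightarrow> h l \<le> g l (b l)"
  shows "lower_function g J b"
  unfolding lower_function_def
proof (intro ballI impI conjI)
  fix s t assume st: "s \<in> J" "t \<in> J" "s \<le> t"
  show i: "(\<lambda>l. g l (b l)) integrable_on {s..t}" by (rule int[OF st])
  have "l \<in> J" if "l \<in> {s..t}" for l
    using mem_is_interval_1_I[OF J st(1,2)] that by auto
  then show "b t - b s \<le> integral {s..t} (\<lambda>l. g l (b l))"
    using le by (intro has_integral_le[OF h[OF st] integrable_integral[OF i]]) auto
qed

text \<open>On an interval that contains \<open>c\<close> the two increments add up, and a drop at
  \<open>c\<close> only lowers the total.\<close>

lemma lower_function_glue:
  assumes J: "is_interval J" "c \<in> J"
    and b1: "lower_function g (J \<inter> {..c}) b1" and b2: "lower_function g (J \<inter> {c..}) b2"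
    and jump: "b2 c \<le> b1 c"
  shows "lower_function g J (\<lambda>t. if t < c then b1 t else b2 t)"
  unfolding lower_function_def
proof (intro ballI impI)
  define b where "b t = (if t < c then b1 t else b2 t)" for t
  fix s t assume st: "s \<in> J" "t \<in> J" "s \<le> t"
  \<comment> \<open>At \<open>c\<close> the glued function already takes the value of
    \<open>b2\<close>, so on an interval ending there it may differ from \<open>b1\<close> at that
    one point.\<close>
  have B1: "((\<lambda>l. g l (b l)) has_integral integral {s'..t'} (\<lambda>l. g l (b1 l))) {s'..t'}"
    if "(\<lambda>l. g l (b1 l)) integrable_on {s'..t'}" "t' \<le> c" for s' t'
    by (rule has_integral_spike_finite[where S = "{c}", OF _ _ integrable_integral[OF that(1)]])
       (use that(2) in \<open>auto simp: b_def\<close>)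
  have B2: "((\<lambda>l. g l (b l)) has_integral integral {s'..t'} (\<lambda>l. g l (b2 l))) {s'..t'}"
    if "(\<lambda>l. g l (b2 l)) integrable_on {s'..t'}" "c \<le> s'" for s' t'
    by (rule has_integral_eq[OF _ integrable_integral[OF that(1)]]) (use that(2) in \<open>auto simp: b_def\<close>)
  have "\<exists>i. ((\<lambda>l. g l (b l)) has_integral i) {s..t} \<and> b t - b s \<le> i"
  proof -
    consider "t < c" | "c \<le> s" | "s < c" "c \<le> t" by linarith
    then show ?thesis
    proof cases
      case 1
      with st have "s \<in> J \<inter> {..c}" "t \<in> J \<inter> {..c}" by auto
      note L = lower_functionD[OF b1 this st(3)]
      show ?thesis using B1[OF L(1)] L(2) 1 st(3)
        by (intro exI[of _ "integral {s..t} (\<lambda>l. g l (b1 l))"]) (auto simp: b_def)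
    next
      case 2
      with st have "s \<in> J \<inter> {c..}" "t \<in> J \<inter> {c..}" by auto
      note L = lower_functionD[OF b2 this st(3)]
      show ?thesis using B2[OF L(1) 2] L(2) 2 st(3)
        by (intro exI[of _ "integral {s..t} (\<lambda>l. g l (b2 l))"]) (auto simp: b_def)
    next
      case 3
      with st J have m: "s \<in> J \<inter> {..c}" "c \<in> J \<inter> {..c}" "c \<in> J \<inter> {c..}" "t \<in> J \<inter> {c..}" by auto
      note L1 = lower_functionD[OF b1 m(1,2) less_imp_le[OF 3(1)]]
      note L2 = lower_functionD[OF b2 m(3,4) 3(2)]
      have "((\<lambda>l. g l (b l)) has_integral integral {s..c} (\<lambda>l. g l (b1 l)) + integral {c..t} (\<lambda>l. g l (b2 l))) {s..t}"
        using 3 by (intro has_integral_combine[OF _ _ B1[OF L1(1)] B2[OF L2(1)]]) auto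
      moreover have "b t - b s \<le> integral {s..c} (\<lambda>l. g l (b1 l)) + integral {c..t} (\<lambda>l. g l (b2 l))"
        using L1(2) L2(2) jump 3 by (simp add: b_def)
      ultimately show ?thesis by blast
    qed
  qed
  then show "(\<lambda>l. g l (if l < c then b1 l else b2 l)) integrable_on {s..t} \<and>
      (if t < c then b1 t else b2 t) - (if s < c then b1 s else b2 s)
        \<le> integral {s..t} (\<lambda>l. g l (if l < c then b1 l else b2 l))"
    unfolding b_def[symmetric] by (auto simp: integral_unique has_integral_integrable)
qed

lemma riccati_const_shift:
  assumes "riccati \<Delta> q D B"
  shows "riccati \<Delta> (\<lambda>t. q t - \<delta>) D (B + \<bar>\<delta>\<bar>)"
proof -
  interpret riccati \<Delta> q D B by fact
  show ?thesis
  proof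
    show "\<bar>q t - \<delta>\<bar> \<le> B + \<bar>\<delta>\<bar>" for t using q_le[of t] by linarith
  qed (auto simp: \<Delta>_le)
qed

lemma (in riccati) integrable_quad_rhs:
  assumes "x \<in> borel_measurable borel" "\<And>l. l \<in> {s..t} \<Longrightarrow> \<bar>x l\<bar> \<le> R"
  shows "(\<lambda>l. g l (x l)) integrable_on {s..t}"
  using quad_rhs_bound[OF assms(2)] by (intro integrable_on_bounded_borel) (use assms(1) in auto)

text \<open>Serves to bring pieces with different slacks to a common one before they are
  glued.\<close>

lemma lower_function_decrease:
  assumes b: "lower_function (quad_rhs \<Delta> (\<lambda>t. q t - \<delta>)) J b"
    and le: "\<delta>' \<le> \<delta>"
  shows "lower_function (quad_rhs \<Delta> (\<lambda>t. q t - \<delta>')) J b"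
  unfolding lower_function_def
proof (intro ballI impI conjI)
  fix s t assume st: "s \<in> J" "t \<in> J" "s \<le> t"
  note L = lower_functionD[OF b st]
  have "(\<lambda>l. quad_rhs \<Delta> (\<lambda>t. q t - \<delta>) l (b l) + (\<delta> - \<delta>')) integrable_on {s..t}"
    by (intro integrable_add L(1) integrable_const_ivl)
  moreover have "(\<lambda>l. quad_rhs \<Delta> (\<lambda>t. q t - \<delta>) l (b l) + (\<delta> - \<delta>')) = (\<lambda>l. quad_rhs \<Delta> (\<lambda>t. q t - \<delta>') l (b l))"
    by (auto simp: quad_rhs_def fun_eq_iff)
  ultimately show i: "(\<lambda>l. quad_rhs \<Delta> (\<lambda>t. q t - \<delta>') l (b l)) integrable_on {s..t}" by simp
  have "integral {s..t} (\<lambda>l. quad_rhs \<Delta> (\<lambda>t. q t - \<delta>) l (b l)) \<le> integral {s..t} (\<lambda>l. quad_rhs \<Delta> (\<lambda>t. q t - \<delta>') l (b l))"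
    using le by (intro integral_le L(1) i) (simp add: quad_rhs_def)
  with L(2) show "b t - b s \<le> integral {s..t} (\<lambda>l. quad_rhs \<Delta> (\<lambda>t. q t - \<delta>') l (b l))" by linarith
qed

text \<open>Near \<open>-\<infinity>\<close> the solution \<open>y\<close> is mixed with the midline of the limiting strip, and concavity of the
  right-hand side provides the slack; afterwards an exponentially growing multiple of the slack
  already gained is subtracted from \<open>y\<close>.\<close>

lemma strict_lower_function_left:
  assumes ric: "riccati \<Gamma> p D B"
    and y: "integral_solution (quad_rhs \<Gamma> p) {..\<tau>} y" "y \<in> borel_measurable borel" "\<And>t. t \<le> \<tau> \<Longrightarrow> \<bar>y t\<bar> \<le> R"
    and a: "integral_solution (quad_rhs (\<lambda>_. 0) p) UNIV a" "a \<in> borel_measurable borel" "\<And>t. \<bar>a t\<bar> \<le> R"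
    and r: "integral_solution (quad_rhs (\<lambda>_. 0) p) UNIV r" "r \<in> borel_measurable borel" "\<And>t. \<bar>r t\<bar> \<le> R"
    and \<kappa>: "\<kappa> > 0" "\<And>t. \<kappa> \<le> a t - r t"
    and lim: "(\<Gamma> \<longlongrightarrow> \<gamma>) at_bot" and \<theta>: "\<theta> > 0"
  obtains \<delta> b R' where "\<delta> > 0" "b \<in> borel_measurable borel" "\<And>t. t \<le> \<tau> \<Longrightarrow> \<bar>b t\<bar> \<le> R'"
    "lower_function (quad_rhs \<Gamma> (\<lambda>t. p t - \<delta>)) {..\<tau>} b" "y \<tau> - \<theta> \<le> b \<tau>"
proof -
  interpret riccati \<Gamma> p D B by (rule ric)
  note [measurable] = y(2) a(2) r(2)
  have R0: "R \<ge> 0" using a(3)[of 0] by linarith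
  \<comment> \<open>At the midpoint \<open>m\<close> of \<open>a\<close> and \<open>r\<close> the
    square falls short of the mean of the squares by (a - r)^2 / 4, hence by at least
    \<open>\<kappa>\<^sup>2 / 4\<close>. The tolerance \<open>e1\<close> for the distance of
    \<open>\<Gamma>\<close> from its limit costs at most half of that.\<close>
  define e1 where "e1 = min 1 (\<kappa>\<^sup>2 / (8 * (2 * R + 1)))"
  have e1: "e1 > 0" "e1 \<le> 1" "2 * R * e1 + e1\<^sup>2 \<le> \<kappa>\<^sup>2 / 8"
  proof -
    show "e1 > 0" "e1 \<le> 1" using \<kappa> R0 by (auto simp: e1_def)
    have "e1\<^sup>2 \<le> e1" using \<open>e1 > 0\<close> \<open>e1 \<le> 1\<close> by (simp add: power2_eq_square mult_left_le)
    then have "2 * R * e1 + e1\<^sup>2 \<le> (2 * R + 1) * e1" by (simp add: algebra_simps)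
    also have "\<dots> \<le> (2 * R + 1) * (\<kappa>\<^sup>2 / (8 * (2 * R + 1)))"
      using R0 by (intro mult_left_mono) (auto simp: e1_def)
    also have "\<dots> = \<kappa>\<^sup>2 / 8" using R0 by (simp add: field_simps)
    finally show "2 * R * e1 + e1\<^sup>2 \<le> \<kappa>\<^sup>2 / 8" .
  qed
  have "\<forall>\<^sub>F t in at_bot. dist (\<Gamma> t) \<gamma> < e1" using lim e1(1) by (rule tendstoD)
  then obtain T0 where T0: "\<And>t. t \<le> T0 \<Longrightarrow> dist (\<Gamma> t) \<gamma> < e1" by (auto simp: eventually_at_bot_linorder)
  define T where "T = min T0 \<tau>"
  have T: "\<bar>\<gamma> - \<Gamma> t\<bar> \<le> e1" if "t \<le> T" for t
    using T0[of t] that by (auto simp: T_def dist_real_def)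
  have T\<tau>: "T \<le> \<tau>" by (simp add: T_def)
  define \<eta> where "\<eta> = min \<theta> 1"
  \<comment> \<open>Replacing y by y - w changes the right-hand side by 2 w (y - \<Gamma>) - w^2,
    which is at least -2 (R + D) w - w. The rate \<open>L\<close> pays for this and has one more
    \<open>w\<close> left for the slack \<delta> \<le> w.\<close>
  define L where "L = 2 * (R + D) + 2"
  define w where "w t = \<eta> * exp (L * (t - \<tau>))" for t
  have \<eta>: "\<eta> > 0" "\<eta> \<le> 1" "\<eta> \<le> \<theta>" using \<theta> by (auto simp: \<eta>_def)
  have L: "L > 0" using R0 D_nonneg by (simp add: L_def)
  have w: "w t > 0" "w t \<le> 1" if "t \<le> \<tau>" for t
  proof -
    show "w t > 0" using \<eta> by (simp add: w_def)
    have "exp (L * (t - \<tau>)) \<le> 1" using that L by (simp add: mult_le_0_iff)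
    then have "\<eta> * exp (L * (t - \<tau>)) \<le> 1 * 1" using \<eta> by (intro mult_mono) auto
    then show "w t \<le> 1" by (simp add: w_def)
  qed
  have wmono: "w s \<le> w t" if "s \<le> t" for s t
    using that \<eta> L by (simp add: w_def)
  \<comment> \<open>The weight of the midline is so small that mixing it in displaces
    \<open>y\<close> at \<open>T\<close> by at most \<open>w T\<close> downwards. The change from
    \<open>b1\<close> to \<open>b2\<close> at \<open>T\<close> is then not an upward jump.\<close>
  define \<epsilon> where "\<epsilon> = min 1 (w T / (2 * R + \<bar>\<gamma>\<bar> + 1))"
  have \<epsilon>: "\<epsilon> > 0" "\<epsilon> \<le> 1" "\<epsilon> * (2 * R + \<bar>\<gamma>\<bar>) \<le> w T"
  proof -
    show "\<epsilon> > 0" "\<epsilon> \<le> 1" using w[OF T\<tau>] R0 by (auto simp: \<epsilon>_def)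
    have "\<epsilon> * (2 * R + \<bar>\<gamma>\<bar>) \<le> \<epsilon> * (2 * R + \<bar>\<gamma>\<bar> + 1)" using \<open>\<epsilon> > 0\<close> by simp
    also have "\<dots> \<le> w T / (2 * R + \<bar>\<gamma>\<bar> + 1) * (2 * R + \<bar>\<gamma>\<bar> + 1)"
      using R0 by (intro mult_right_mono) (auto simp: \<epsilon>_def)
    also have "\<dots> = w T" using R0 by (simp add: add_nonneg_pos less_imp_neq[symmetric])
    finally show "\<epsilon> * (2 * R + \<bar>\<gamma>\<bar>) \<le> w T" .
  qed
  \<comment> \<open>The first entry is the slack available after \<open>T\<close>, where
    \<open>w\<close> is increasing; the second is the slack of the mixture before
    \<open>T\<close>.\<close>
  define \<delta> where "\<delta> = min (w T) (\<epsilon> * \<kappa>\<^sup>2 / 8)"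
  have \<delta>: "\<delta> > 0" "\<delta> \<le> w T" "\<delta> \<le> \<epsilon> * \<kappa>\<^sup>2 / 8" using w[OF T\<tau>] \<epsilon> \<kappa> by (auto simp: \<delta>_def)
  interpret sh: riccati \<Gamma> "\<lambda>t. p t - \<delta>" D "B + \<bar>\<delta>\<bar>" by (rule riccati_const_shift[OF ric])
  \<comment> \<open>The midline between \<gamma> + r and \<gamma> + a, which solve the equation with
    \<open>\<Gamma>\<close> frozen at its limit.\<close>
  define c where "c t = \<gamma> + (a t + r t) / 2" for t
  have cb: "\<bar>c t\<bar> \<le> \<bar>\<gamma>\<bar> + R" for t
  proof -
    have "\<bar>(a t + r t) / 2\<bar> \<le> R" using a(3)[of t] r(3)[of t] by (simp add: abs_le_iff)
    then show ?thesis unfolding c_def using abs_triangle_ineq[of \<gamma> "(a t + r t) / 2"] by linarith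
  qed
  define b1 where "b1 t = (1 - \<epsilon>) * y t + \<epsilon> * c t" for t
  define b2 where "b2 t = y t - w t" for t
  have [measurable]: "b1 \<in> borel_measurable borel" "b2 \<in> borel_measurable borel"
    unfolding b1_def b2_def c_def w_def by measurable
  define R' where "R' = 2 * R + \<bar>\<gamma>\<bar> + 1"
  have b1b: "\<bar>b1 t\<bar> \<le> R'" if "t \<le> \<tau>" for t
  proof -
    have "\<bar>(1 - \<epsilon>) * y t\<bar> \<le> 1 * R"
      unfolding abs_mult using \<epsilon> y(3)[OF that] by (intro mult_mono) auto
    moreover have "\<bar>\<epsilon> * c t\<bar> \<le> 1 * (\<bar>\<gamma>\<bar> + R)"
      unfolding abs_mult using \<epsilon> cb[of t] by (intro mult_mono) auto
    ultimately have "\<bar>(1 - \<epsilon>) * y t\<bar> \<le> R" "\<bar>\<epsilon> * c t\<bar> \<le> \<bar>\<gamma>\<bar> + R" by simp_all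
    then show ?thesis unfolding b1_def R'_def by linarith
  qed
  have b2b: "\<bar>b2 t\<bar> \<le> R'" if "t \<le> \<tau>" for t
    using y(3)[OF that] w[OF that] R0 unfolding b2_def R'_def by linarith
  have "lower_function sh.g ({..\<tau>} \<inter> {..T}) b1"
  proof (rule lower_functionI[where h = "\<lambda>l. (1 - \<epsilon>) * g l (y l) +
        \<epsilon> * ((quad_rhs (\<lambda>_. 0) p l (a l) + quad_rhs (\<lambda>_. 0) p l (r l)) / 2)"])
    show "is_interval ({..\<tau>} \<inter> {..T})" by (intro is_interval_Int is_interval_ic)
    fix s t assume "s \<in> {..\<tau>} \<inter> {..T}" "t \<in> {..\<tau>} \<inter> {..T}" and st: "s \<le> t"
    then have m: "s \<in> {..\<tau>}" "t \<in> {..\<tau>}" by auto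
    show "(\<lambda>l. sh.g l (b1 l)) integrable_on {s..t}"
      using m b1b by (intro sh.integrable_quad_rhs[where R = R']) auto
    have "((\<lambda>l. (1 - \<epsilon>) * g l (y l) +
        \<epsilon> * ((quad_rhs (\<lambda>_. 0) p l (a l) + quad_rhs (\<lambda>_. 0) p l (r l)) / 2)) has_integral
        (1 - \<epsilon>) * (y t - y s) + \<epsilon> * ((a t - a s + (r t - r s)) / 2)) {s..t}"
      by (intro has_integral_add has_integral_mult_right has_integral_divide
          integral_solutionD[OF y(1) m st] integral_solutionD[OF a(1) _ _ st] integral_solutionD[OF r(1) _ _ st]) auto
    moreover have "(1 - \<epsilon>) * (y t - y s) + \<epsilon> * ((a t - a s + (r t - r s)) / 2) = b1 t - b1 s"
      by (simp add: b1_def c_def field_simps)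
    ultimately show "((\<lambda>l. (1 - \<epsilon>) * g l (y l) +
        \<epsilon> * ((quad_rhs (\<lambda>_. 0) p l (a l) + quad_rhs (\<lambda>_. 0) p l (r l)) / 2)) has_integral b1 t - b1 s) {s..t}"
      by simp
  next
    fix l assume "l \<in> {..\<tau>} \<inter> {..T}"
    then have l: "l \<le> T" by simp
    define Y C m e where "Y = y l - \<Gamma> l" and "C = c l - \<Gamma> l" and "m = (a l + r l) / 2" and "e = \<gamma> - \<Gamma> l"
    have mR: "\<bar>m\<bar> \<le> R" using a(3)[of l] r(3)[of l] by (simp add: m_def abs_le_iff)
    have eb: "\<bar>e\<bar> \<le> e1" using T[OF l] by (simp add: e_def)
    have "2 * (m * e) \<le> 2 * (R * e1)"
      using mult_mono[OF mR eb] R0 abs_le_D1[of "m * e"] by (simp add: abs_mult)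
    moreover have "e\<^sup>2 \<le> e1\<^sup>2" using eb by (metis abs_ge_zero power2_abs power_mono)
    ultimately have "(m + e)\<^sup>2 \<le> m\<^sup>2 + \<kappa>\<^sup>2 / 8" using e1(3) by (simp add: power2_sum)
    then have C2: "C\<^sup>2 \<le> m\<^sup>2 + \<kappa>\<^sup>2 / 8" by (simp add: C_def m_def e_def c_def algebra_simps)
    have "\<kappa>\<^sup>2 \<le> (a l - r l)\<^sup>2" using \<kappa> by (intro power_mono) (auto intro: less_imp_le)
    moreover have "m\<^sup>2 = ((a l)\<^sup>2 + (r l)\<^sup>2) / 2 - (a l - r l)\<^sup>2 / 4"
      by (simp add: m_def power2_eq_square field_simps)
    ultimately have "C\<^sup>2 \<le> ((a l)\<^sup>2 + (r l)\<^sup>2) / 2 - \<kappa>\<^sup>2 / 8" using C2 by linarith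
    then have eC: "\<epsilon> * C\<^sup>2 \<le> \<epsilon> * (((a l)\<^sup>2 + (r l)\<^sup>2) / 2 - \<kappa>\<^sup>2 / 8)" using \<epsilon> by (intro mult_left_mono) auto
    have "b1 l - \<Gamma> l = (1 - \<epsilon>) * Y + \<epsilon> * C" by (simp add: b1_def Y_def C_def algebra_simps)
    moreover have "(1 - \<epsilon>) * Y\<^sup>2 + \<epsilon> * C\<^sup>2 - ((1 - \<epsilon>) * Y + \<epsilon> * C)\<^sup>2 = \<epsilon> * (1 - \<epsilon>) * (Y - C)\<^sup>2"
      by (simp add: power2_eq_square algebra_simps)
    ultimately have "(1 - \<epsilon>) * Y\<^sup>2 + \<epsilon> * C\<^sup>2 - (b1 l - \<Gamma> l)\<^sup>2 = \<epsilon> * (1 - \<epsilon>) * (Y - C)\<^sup>2"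
      by (simp only:)
    moreover have "\<epsilon> * (1 - \<epsilon>) * (Y - C)\<^sup>2 \<ge> 0" using \<epsilon> by simp
    ultimately have "(b1 l - \<Gamma> l)\<^sup>2 \<le> (1 - \<epsilon>) * Y\<^sup>2 + \<epsilon> * (((a l)\<^sup>2 + (r l)\<^sup>2) / 2 - \<kappa>\<^sup>2 / 8)"
      using eC by linarith
    then show "(1 - \<epsilon>) * g l (y l) + \<epsilon> * ((quad_rhs (\<lambda>_. 0) p l (a l) + quad_rhs (\<lambda>_. 0) p l (r l)) / 2)
        \<le> sh.g l (b1 l)"
      using \<delta>(3) by (simp add: quad_rhs_def Y_def algebra_simps add_divide_distrib diff_divide_distrib)
  qed
  moreover have "lower_function sh.g ({..\<tau>} \<inter> {T..}) b2"
  proof (rule lower_functionI[where h = "\<lambda>l. g l (y l) - L * w l"])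
    show "is_interval ({..\<tau>} \<inter> {T..})" by (intro is_interval_Int is_interval_ic is_interval_ci)
    fix s t assume "s \<in> {..\<tau>} \<inter> {T..}" "t \<in> {..\<tau>} \<inter> {T..}" and st: "s \<le> t"
    then have m: "s \<in> {..\<tau>}" "t \<in> {..\<tau>}" by auto
    show "(\<lambda>l. sh.g l (b2 l)) integrable_on {s..t}"
      using m b2b by (intro sh.integrable_quad_rhs[where R = R']) auto
    have "((\<lambda>l. L * w l) has_integral w t - w s) {s..t}"
      using st unfolding w_def
      by (intro fundamental_theorem_of_calculus)
         (auto intro!: derivative_eq_intros simp: has_real_derivative_iff_has_vector_derivative[symmetric])
    from has_integral_diff[OF integral_solutionD[OF y(1) m st] this]
    show "((\<lambda>l. g l (y l) - L * w l) has_integral b2 t - b2 s) {s..t}"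
      by (simp add: b2_def algebra_simps)
  next
    fix l assume "l \<in> {..\<tau>} \<inter> {T..}"
    then have l: "l \<le> \<tau>" "T \<le> l" by auto
    have "y l - \<Gamma> l \<ge> - (R + D)" using y(3)[OF l(1)] \<Delta>_le[of l] by (simp add: abs_le_iff)
    then have "w l * (y l - \<Gamma> l) \<ge> w l * - (R + D)" using w(1)[OF l(1)] by (intro mult_left_mono) auto
    moreover have "(w l)\<^sup>2 \<le> w l" using w[OF l(1)] by (simp add: power2_eq_square mult_left_le)
    moreover have "\<delta> \<le> w l" using \<delta>(2) wmono[OF l(2)] by linarith
    moreover have "sh.g l (b2 l) = g l (y l) + 2 * (w l * (y l - \<Gamma> l)) - (w l)\<^sup>2 - \<delta>"
      by (simp add: quad_rhs_def b2_def power2_eq_square algebra_simps)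
    moreover have "L * w l = - 2 * (w l * - (R + D)) + 2 * w l" by (simp add: L_def algebra_simps)
    ultimately show "g l (y l) - L * w l \<le> sh.g l (b2 l)" by linarith
  qed
  moreover have "b2 T \<le> b1 T"
  proof -
    have "y T - c T \<le> 2 * R + \<bar>\<gamma>\<bar>" using y(3)[OF T\<tau>] cb[of T] by linarith
    then have "\<epsilon> * (y T - c T) \<le> w T" using \<epsilon> by (meson less_imp_le mult_left_mono order_trans)
    then show ?thesis by (simp add: b1_def b2_def algebra_simps)
  qed
  ultimately have "lower_function sh.g {..\<tau>} (\<lambda>t. if t < T then b1 t else b2 t)"
    using T\<tau> by (intro lower_function_glue) auto
  moreover have "y \<tau> - \<theta> \<le> b2 \<tau>" using \<eta> by (simp add: b2_def w_def)
  ultimately show ?thesis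
    using that[of \<delta> "\<lambda>t. if t < T then b1 t else b2 t" R'] \<delta>(1) b1b b2b T\<tau> by auto
qed

text \<open>The reflected form of the left case. Reflection exchanges attractor and repeller, so
  \<open>r\<close> enters in the place of \<open>a\<close> and vice versa.\<close>

lemma strict_lower_function_right:
  assumes ric: "riccati \<Gamma> p D B"
    and y: "integral_solution (quad_rhs \<Gamma> p) {\<tau>..} y" "y \<in> borel_measurable borel" "\<And>t. \<tau> \<le> t \<Longrightarrow> \<bar>y t\<bar> \<le> R"
    and a: "integral_solution (quad_rhs (\<lambda>_. 0) p) UNIV a" "a \<in> borel_measurable borel" "\<And>t. \<bar>a t\<bar> \<le> R"
    and r: "integral_solution (quad_rhs (\<lambda>_. 0) p) UNIV r" "r \<in> borel_measurable borel" "\<And>t. \<bar>r t\<bar> \<le> R"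
    and \<kappa>: "\<kappa> > 0" "\<And>t. \<kappa> \<le> a t - r t"
    and lim: "(\<Gamma> \<longlongrightarrow> \<gamma>) at_top" and \<theta>: "\<theta> > 0"
  obtains \<delta> b R' where "\<delta> > 0" "b \<in> borel_measurable borel" "\<And>t. \<tau> \<le> t \<Longrightarrow> \<bar>b t\<bar> \<le> R'"
    "lower_function (quad_rhs \<Gamma> (\<lambda>t. p t - \<delta>)) {\<tau>..} b" "b \<tau> \<le> y \<tau> + \<theta>"
proof -
  note [measurable] = y(2) a(2) r(2)
  have half: "uminus ` {\<tau>..} = {..- \<tau>}" "uminus ` {..- \<tau>} = {\<tau>..}" by auto
  have lim': "((\<lambda>t. - \<Gamma> (- t)) \<longlongrightarrow> - \<gamma>) at_bot"
    using filterlim_compose[OF lim filterlim_uminus_at_top_at_bot] by (intro tendsto_minus)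
  have sol: "integral_solution (quad_rhs (\<lambda>_. 0) (\<lambda>t. p (- t))) UNIV (\<lambda>t. - x (- t))"
    if "integral_solution (quad_rhs (\<lambda>_. 0) p) UNIV x" for x
    using integral_solution_reflect[OF that] by (simp add: quad_rhs_reflect surj_uminus)
  have y': "integral_solution (quad_rhs (\<lambda>t. - \<Gamma> (- t)) (\<lambda>t. p (- t))) {..- \<tau>} (\<lambda>t. - y (- t))"
    using integral_solution_reflect[OF y(1)] by (simp add: quad_rhs_reflect half)
  have meas: "(\<lambda>t. - y (- t)) \<in> borel_measurable borel" "(\<lambda>t. - a (- t)) \<in> borel_measurable borel"
    "(\<lambda>t. - r (- t)) \<in> borel_measurable borel" by measurable
  have bd: "\<bar>- a (- t)\<bar> \<le> R" "\<bar>- r (- t)\<bar> \<le> R" "\<kappa> \<le> - r (- t) - - a (- t)" for t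
    using a(3) r(3) \<kappa>(2)[of "- t"] by auto
  have yb: "\<bar>- y (- t)\<bar> \<le> R" if "t \<le> - \<tau>" for t using y(3)[of "- t"] that by auto
  obtain \<delta> b R' where b: "\<delta> > 0" "b \<in> borel_measurable borel" "\<And>t. t \<le> - \<tau> \<Longrightarrow> \<bar>b t\<bar> \<le> R'"
    "lower_function (quad_rhs (\<lambda>t. - \<Gamma> (- t)) (\<lambda>t. p (- t) - \<delta>)) {..- \<tau>} b" "- y (- (- \<tau>)) - \<theta> \<le> b (- \<tau>)"
    by (rule strict_lower_function_left[OF riccati.riccati_reflect[OF ric] y' meas(1) yb
        sol[OF r(1)] meas(3) bd(2) sol[OF a(1)] meas(2) bd(1) \<kappa>(1) bd(3) lim' \<theta>], assumption)
       (rule that; assumption)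
  note [measurable] = b(2)
  have "lower_function (quad_rhs \<Gamma> (\<lambda>t. p t - \<delta>)) {\<tau>..} (\<lambda>t. - b (- t))"
    using lower_function_reflect[OF b(4)] by (simp add: quad_rhs_reflect half)
  then show ?thesis using that[of \<delta> "\<lambda>t. - b (- t)" R'] b by auto
qed

text \<open>With u = a - r, the right-hand side at the moving combination exceeds its derivative by
  \<nu> (1 - \<nu>) u^2 - \<nu>' u - \<Gamma>': the first term is the convexity gap of the square,
  and \<open>p\<close> cancels. Here \<nu> (1 - \<nu>) is the bracket in the assumed inequality and
  \<nu>' = -2 \<alpha> / (t2 - t1). Continuity on the compact interval turns strictness into a
  uniform \<delta>.\<close>

lemma strict_lower_function_middle:
  fixes \<alpha> t1 t2 :: real
  defines "\<nu> \<equiv> \<lambda>t. 1 / 2 + \<alpha> * (t2 + t1 - 2 * t) / (t2 - t1)"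
  assumes ric: "riccati \<Gamma> p D B" and ric0: "riccati (\<lambda>_. 0) p D0 B"
    and a: "integral_solution (quad_rhs (\<lambda>_. 0) p) UNIV a" "\<And>t. \<bar>a t\<bar> \<le> R"
    and r: "integral_solution (quad_rhs (\<lambda>_. 0) p) UNIV r" "\<And>t. \<bar>r t\<bar> \<le> R"
    and t12: "t1 < t2"
    and \<Gamma>': "\<And>t. t \<in> {t1..t2} \<Longrightarrow> (\<Gamma> has_real_derivative \<Gamma>' t) (at t within {t1..t2})"
    and cont: "continuous_on {t1..t2} \<Gamma>'"
    and ineq: "\<And>t. t \<in> {t1..t2} \<Longrightarrow>
      (1 / 4 - \<alpha>\<^sup>2 * (t2 + t1 - 2 * t)\<^sup>2 / (t2 - t1)\<^sup>2) * (a t - r t)\<^sup>2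
        + 2 * \<alpha> / (t2 - t1) * (a t - r t) > \<Gamma>' t"
  obtains \<delta> R' where "\<delta> > 0"
    "lower_function (quad_rhs \<Gamma> (\<lambda>t. p t - \<delta>)) {t1..t2} (\<lambda>t. \<nu> t * a t + (1 - \<nu> t) * r t + \<Gamma> t)"
    "\<And>t. t \<in> {t1..t2} \<Longrightarrow> \<bar>\<nu> t * a t + (1 - \<nu> t) * r t + \<Gamma> t\<bar> \<le> R'"
    "(\<lambda>t. \<nu> t * a t + (1 - \<nu> t) * r t + \<Gamma> t) \<in> borel_measurable borel"
proof -
  interpret riccati \<Gamma> p D B by (rule ric)
  interpret z: riccati "\<lambda>_. 0" p D0 B by (rule ric0)
  note [measurable] = z.solution_meas[OF a] z.solution_meas[OF r]
  define b where "b t = \<nu> t * a t + (1 - \<nu> t) * r t + \<Gamma> t" for t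
  have acont: "continuous_on S a" and rcont: "continuous_on S r" for S
    using lipschitz_on_continuous_on[OF z.bounded_solution_lipschitz[OF a]]
      lipschitz_on_continuous_on[OF z.bounded_solution_lipschitz[OF r]] by (auto intro: continuous_on_subset)
  have \<nu>cont: "continuous_on S \<nu>" for S unfolding \<nu>_def by (intro continuous_intros) (use t12 in auto)
  have meas: "b \<in> borel_measurable borel"
    using borel_measurable_continuous_onI[OF \<nu>cont] unfolding b_def by measurable
  have \<Gamma>cont: "continuous_on {t1..t2} \<Gamma>"
    using DERIV_continuous[OF \<Gamma>'] by (auto simp: continuous_on_eq_continuous_within)
  have "continuous_on {t1..t2} b"
    unfolding b_def by (intro continuous_intros acont rcont \<nu>cont \<Gamma>cont)
  then have "bounded (b ` {t1..t2})" by (intro compact_imp_bounded compact_continuous_image) auto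
  then obtain R' where R': "\<And>t. t \<in> {t1..t2} \<Longrightarrow> \<bar>b t\<bar> \<le> R'" unfolding bounded_iff real_norm_def by (metis imageI)
  define \<phi> where "\<phi> t = (1 / 4 - \<alpha>\<^sup>2 * (t2 + t1 - 2 * t)\<^sup>2 / (t2 - t1)\<^sup>2) * (a t - r t)\<^sup>2
        + 2 * \<alpha> / (t2 - t1) * (a t - r t) - \<Gamma>' t" for t
  have "continuous_on {t1..t2} \<phi>"
    unfolding \<phi>_def by (intro continuous_intros acont rcont cont) (use t12 in auto)
  then obtain t0 where t0: "t0 \<in> {t1..t2}" "\<And>t. t \<in> {t1..t2} \<Longrightarrow> \<phi> t0 \<le> \<phi> t"
    using continuous_attains_inf[of "{t1..t2}" \<phi>] t12 by auto
  define \<delta> where "\<delta> = \<phi> t0"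
  have \<delta>: "\<delta> > 0" using ineq[OF t0(1)] by (simp add: \<delta>_def \<phi>_def)
  interpret sh: riccati \<Gamma> "\<lambda>t. p t - \<delta>" D "B + \<bar>\<delta>\<bar>" by (rule riccati_const_shift[OF ric])
  define \<nu>' where "\<nu>' = - 2 * \<alpha> / (t2 - t1)"
  define u where "u t = a t - r t" for t
  have d\<nu>: "(\<nu> has_real_derivative \<nu>') (at t within S)" for t S
    unfolding \<nu>_def \<nu>'_def using t12 by (auto intro!: derivative_eq_intros)
  have \<nu>I: "(\<bar>\<nu>'\<bar>)-lipschitz_on {s..t} \<nu>" for s t
  proof (rule has_integral_imp_lipschitz_on[where g = "\<lambda>_. \<nu>'"])
    show "((\<lambda>_. \<nu>') has_integral \<nu> t' - \<nu> s') {s'..t'}" if "s' \<le> t'" for s' t'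
      using that d\<nu> by (intro fundamental_theorem_of_calculus)
        (auto simp: has_real_derivative_iff_has_vector_derivative[symmetric])
  qed auto
  have uI: "\<exists>C. C-lipschitz_on {s..t} u" for s t
    unfolding u_def using lipschitz_on_diff[OF z.bounded_solution_lipschitz[OF a] z.bounded_solution_lipschitz[OF r]]
    by (auto intro: lipschitz_on_subset)
  have "lower_function sh.g {t1..t2} b"
  proof (rule lower_functionI[where h = "\<lambda>l. \<nu>' * u l + \<nu> l * (z.g l (a l) - z.g l (r l)) + z.g l (r l) + \<Gamma>' l"])
    show "is_interval {t1..t2}" by (rule is_interval_cc)
    fix s t assume m: "s \<in> {t1..t2}" "t \<in> {t1..t2}" and st: "s \<le> t"
    show "(\<lambda>l. sh.g l (b l)) integrable_on {s..t}"
      using m R' meas by (intro sh.integrable_quad_rhs[where R = R']) auto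
    have "((\<lambda>l. \<nu>' * u l + \<nu> l * (z.g l (a l) - z.g l (r l))) has_integral \<nu> t * u t - \<nu> s * u s) {s..t}"
    proof (rule abs_continuous_has_integral[OF st])
      obtain C where "C-lipschitz_on {s..t} u" using uI by blast
      from lipschitz_on_Icc_times[OF \<nu>I this]
      show "abs_continuous_on {s..t} (\<lambda>l. \<nu> l * u l)" using lipschitz_imp_abs_continuous_on by blast
      show "AE l in lebesgue. l \<in> {s..t} \<longrightarrow> ((\<lambda>l. \<nu> l * u l) has_real_derivative
          \<nu>' * u l + \<nu> l * (z.g l (a l) - z.g l (r l))) (at l within {s..t})"
        using z.AE_derivative[OF a(1)] z.AE_derivative[OF r(1)]
      proof eventually_elim
        case (elim l)
        have "((\<lambda>l. \<nu> l * u l) has_real_derivative \<nu>' * u l + (z.g l (a l) - z.g l (r l)) * \<nu> l) (at l)"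
          unfolding u_def using elim by (intro DERIV_mult' DERIV_diff d\<nu>[of l UNIV, simplified] DERIV_mult) 
        then show ?case by (auto intro: has_field_derivative_at_within simp: algebra_simps)
      qed
    qed
    moreover have "((\<lambda>l. z.g l (r l)) has_integral r t - r s) {s..t}"
      using integral_solutionD[OF r(1) _ _ st] by simp
    moreover have "(\<Gamma>' has_integral \<Gamma> t - \<Gamma> s) {s..t}"
      using st m by (intro fundamental_theorem_of_calculus)
        (auto simp: has_real_derivative_iff_has_vector_derivative[symmetric] intro!: DERIV_subset[OF \<Gamma>'])
    ultimately have "((\<lambda>l. \<nu>' * u l + \<nu> l * (z.g l (a l) - z.g l (r l)) + z.g l (r l) + \<Gamma>' l) has_integral
        (\<nu> t * u t - \<nu> s * u s) + (r t - r s) + (\<Gamma> t - \<Gamma> s)) {s..t}"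
      by (intro has_integral_add)
    moreover have "(\<nu> t * u t - \<nu> s * u s) + (r t - r s) + (\<Gamma> t - \<Gamma> s) = b t - b s"
      by (simp add: b_def u_def algebra_simps)
    ultimately show "((\<lambda>l. \<nu>' * u l + \<nu> l * (z.g l (a l) - z.g l (r l)) + z.g l (r l) + \<Gamma>' l) has_integral b t - b s) {s..t}"
      by simp
  next
    fix l assume l: "l \<in> {t1..t2}"
    have "\<nu> l * (1 - \<nu> l) = 1 / 4 - \<alpha>\<^sup>2 * (t2 + t1 - 2 * l)\<^sup>2 / (t2 - t1)\<^sup>2"
    proof -
      define k where "k = \<alpha> * (t2 + t1 - 2 * l) / (t2 - t1)"
      have "\<nu> l = 1 / 2 + k" by (simp add: \<nu>_def k_def)
      then have "\<nu> l * (1 - \<nu> l) = 1 / 4 - k\<^sup>2" by (simp add: power2_eq_square algebra_simps)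
      then show ?thesis by (simp add: k_def power_divide power_mult_distrib)
    qed
    then have "\<nu> l * (1 - \<nu> l) * (u l)\<^sup>2 - \<nu>' * u l - \<Gamma>' l \<ge> \<delta>"
      using t0(2)[OF l] by (simp add: \<delta>_def \<phi>_def u_def \<nu>'_def)
    moreover have "sh.g l (b l) - (\<nu>' * u l + \<nu> l * (z.g l (a l) - z.g l (r l)) + z.g l (r l) + \<Gamma>' l)
        = \<nu> l * (1 - \<nu> l) * (u l)\<^sup>2 - \<nu>' * u l - \<Gamma>' l - \<delta>"
      by (simp add: quad_rhs_def b_def u_def power2_eq_square algebra_simps)
    ultimately show "\<nu>' * u l + \<nu> l * (z.g l (a l) - z.g l (r l)) + z.g l (r l) + \<Gamma>' l \<le> sh.g l (b l)" by linarith
  qed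
  then show ?thesis using that[OF \<delta>] R' meas unfolding b_def by blast
qed

text \<open>The argument of the square moves from x to x + y with |y| \<le> 2 e, and the square
  grows by y (2 x + y), at most 2 e (2 (R + D) + 2). The last hypothesis says that the slack covers
  this.\<close>

lemma lower_function_perturb:
  assumes b: "lower_function (quad_rhs \<Delta> (\<lambda>t. q t - \<delta>)) UNIV b" "b \<in> borel_measurable borel" "\<And>t. \<bar>b t\<bar> \<le> R"
    and D: "\<And>t. \<bar>\<Delta> t\<bar> \<le> D" and ric: "riccati \<Delta>' q D' B"
    and near: "\<And>t. \<bar>\<Delta>' t - \<Delta> t\<bar> \<le> e" "\<bar>c\<bar> \<le> e" "e \<le> 1" "4 * e * (R + D + 1) \<le> \<delta>"
  shows "lower_function (quad_rhs \<Delta>' q) UNIV (\<lambda>t. b t + c)"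
  unfolding lower_function_def
proof (intro ballI impI conjI)
  interpret riccati \<Delta>' q D' B by (rule ric)
  note [measurable] = b(2)
  fix s t :: real assume st: "s \<le> t"
  have "\<bar>b l + c\<bar> \<le> R + \<bar>c\<bar>" for l using b(3)[of l] by linarith
  then show i: "(\<lambda>l. g l (b l + c)) integrable_on {s..t}" by (intro integrable_quad_rhs) auto
  note L = lower_functionD[OF b(1) UNIV_I UNIV_I st]
  have "quad_rhs \<Delta> (\<lambda>t. q t - \<delta>) l (b l) \<le> g l (b l + c)" for l
  proof -
    define x y where "x = b l - \<Delta> l" and "y = c - (\<Delta>' l - \<Delta> l)"
    have x: "\<bar>x\<bar> \<le> R + D" using b(3)[of l] D[of l] unfolding x_def by linarith
    have y: "\<bar>y\<bar> \<le> 2 * e" using near(1)[of l] near(2) unfolding y_def by linarith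
    have e0: "0 \<le> e" using near(2) by linarith
    have "y * (2 * x + y) \<le> \<bar>y\<bar> * \<bar>2 * x + y\<bar>" by (metis abs_ge_self abs_mult)
    also have "\<dots> \<le> (2 * e) * (2 * (R + D) + 2)"
      using x y near(3) e0 by (intro mult_mono) (auto simp: abs_le_iff)
    also have "\<dots> \<le> \<delta>" using near(4) by (simp add: algebra_simps)
    finally have "y * (2 * x + y) \<le> \<delta>" .
    moreover have "b l + c - \<Delta>' l = x + y" by (simp add: x_def y_def)
    then have "(b l + c - \<Delta>' l)\<^sup>2 = x\<^sup>2 + y * (2 * x + y)"
      by (simp only:) (simp add: power2_eq_square algebra_simps)
    ultimately show ?thesis by (simp add: quad_rhs_def x_def)
  qed
  then have "integral {s..t} (\<lambda>l. quad_rhs \<Delta> (\<lambda>t. q t - \<delta>) l (b l)) \<le> integral {s..t} (\<lambda>l. g l (b l + c))"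
    by (intro integral_le L(1) i)
  with L(2) show "b t + c - (b s + c) \<le> integral {s..t} (\<lambda>l. g l (b l + c))" by linarith
qed

section \<open>Borel representatives, step approximations and half-line solutions\<close>

lemma caratheodory_solution_AE_cong:
  assumes "AE t in lebesgue. q t = q' t"
  shows "caratheodory_solution (quad_rhs \<Delta> q) I x \<longleftrightarrow> caratheodory_solution (quad_rhs \<Delta> q') I x"
proof -
  have "(AE t in lebesgue. t \<in> I \<longrightarrow> (x has_real_derivative quad_rhs \<Delta> q t (x t)) (at t within I)) \<longleftrightarrow>
      (AE t in lebesgue. t \<in> I \<longrightarrow> (x has_real_derivative quad_rhs \<Delta> q' t (x t)) (at t within I))"
    (is "?A \<longleftrightarrow> ?B")
  proof
    assume ?A
    with assms show ?B by eventually_elim (auto simp: quad_rhs_def)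
  next
    assume ?B
    with assms show ?A by eventually_elim (auto simp: quad_rhs_def)
  qed
  then show ?thesis by (simp add: caratheodory_solution_def)
qed

text \<open>The hyperbolicity estimates involve \<open>\<Delta>\<close> but not \<open>q\<close>, so
  only the notion of solution has to be compared.\<close>

lemma attractor_repeller_pair_AE_cong:
  assumes "AE t in lebesgue. q t = q' t"
  shows "attractor_repeller_pair \<Delta> q a r \<longleftrightarrow> attractor_repeller_pair \<Delta> q' a r"
  by (simp add: attractor_repeller_pair_def bounded_solution_def caratheodory_solution_AE_cong[OF assms])

text \<open>Truncating a Borel version makes the essential bound hold everywhere; the level
  \<open>\<bar>B\<bar>\<close> avoids an argument that \<open>B\<close> is nonnegative.\<close>

lemma Linfty_borel_representative:
  assumes "Linfty p"
  obtains p' B where "p' \<in> borel_measurable borel" "\<And>t. \<bar>p' t\<bar> \<le> B" "AE t in lebesgue. p t = p' t"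
proof -
  obtain B where p: "p \<in> borel_measurable lebesgue" and B: "AE t in lebesgue. \<bar>p t\<bar> \<le> B"
    using assms by (auto simp: Linfty_def)
  obtain p1 where p1: "p1 \<in> borel_measurable lborel" "AE t in lborel. p t = p1 t"
    using completion_ex_borel_measurable_real[OF p] by blast
  define p' where "p' t = max (- \<bar>B\<bar>) (min \<bar>B\<bar> (p1 t))" for t
  have "p' \<in> borel_measurable borel" using p1(1) unfolding p'_def by simp
  moreover have "\<bar>p' t\<bar> \<le> \<bar>B\<bar>" for t by (auto simp: p'_def)
  moreover have "AE t in lebesgue. p t = p1 t" using p1(2) by (rule AE_completion)
  then have "AE t in lebesgue. p t = p' t" using B by eventually_elim (auto simp: p'_def abs_le_iff)
  ultimately show ?thesis using that by blast
qed

lemma uniformly_continuous_on_real_limits: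
  fixes f :: "real \<Rightarrow> real"
  assumes cont: "continuous_on UNIV f" and top: "(f \<longlongrightarrow> L) at_top" and bot: "(f \<longlongrightarrow> L') at_bot"
  shows "uniformly_continuous_on UNIV f"
  unfolding uniformly_continuous_on_def
proof (intro allI impI)
  fix e :: real assume e: "e > 0"
  obtain T1 where T1: "\<And>t. t \<ge> T1 \<Longrightarrow> dist (f t) L < e / 2"
    using tendstoD[OF top half_gt_zero[OF e]] by (auto simp: eventually_at_top_linorder)
  obtain T2 where T2: "\<And>t. t \<le> T2 \<Longrightarrow> dist (f t) L' < e / 2"
    using tendstoD[OF bot half_gt_zero[OF e]] by (auto simp: eventually_at_bot_linorder)
  \<comment> \<open>Points at distance less than 1 lie together in one of the two tails or in the
    compact interval enlarged by this margin.\<close>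
  have "uniformly_continuous_on {T2 - 1..T1 + 1} f"
    by (intro compact_uniformly_continuous continuous_on_subset[OF cont]) auto
  then obtain d where d: "d > 0" "\<And>x y. x \<in> {T2 - 1..T1 + 1} \<Longrightarrow> y \<in> {T2 - 1..T1 + 1} \<Longrightarrow> dist y x < d \<Longrightarrow> dist (f y) (f x) < e"
    using e unfolding uniformly_continuous_on_def by meson
  show "\<exists>d>0. \<forall>x\<in>UNIV. \<forall>x'\<in>UNIV. dist x' x < d \<longrightarrow> dist (f x') (f x) < e"
  proof (intro exI[of _ "min d 1"] conjI ballI impI)
    fix x y :: real assume xy: "dist y x < min d 1"
    then have xy1: "\<bar>y - x\<bar> < 1" by (simp add: dist_real_def)
    consider "x \<ge> T1" "y \<ge> T1" | "x \<le> T2" "y \<le> T2" | "x \<in> {T2 - 1..T1 + 1}" "y \<in> {T2 - 1..T1 + 1}"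
      using xy1 by (cases "T1 \<le> x"; cases "T1 \<le> y"; cases "x \<le> T2"; cases "y \<le> T2") auto
    then show "dist (f y) (f x) < e"
    proof cases
      case 1 then show ?thesis using T1 dist_triangle_half_l by blast
    next
      case 2 then show ?thesis using T2 dist_triangle_half_l by blast
    next
      case 3 then show ?thesis using d(2) xy by simp
    qed
  qed (use d in simp)
qed

lemma step_approx_uniform:
  assumes "uniformly_continuous_on UNIV \<Gamma>" and e: "e > 0"
  obtains hs where "hs > 0" "\<And>h t. 0 \<le> h \<Longrightarrow> h \<le> hs \<Longrightarrow> \<bar>step_approx h \<Gamma> t - \<Gamma> t\<bar> \<le> e"
proof -
  have "\<exists>d>0. \<forall>x y. dist y x < d \<longrightarrow> dist (\<Gamma> y) (\<Gamma> x) < e"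
    using assms unfolding uniformly_continuous_on_def by simp
  then obtain d where d: "d > 0" "\<And>x y. dist y x < d \<Longrightarrow> dist (\<Gamma> y) (\<Gamma> x) < e" by blast
  have "\<bar>step_approx h \<Gamma> t - \<Gamma> t\<bar> \<le> e" if h: "0 \<le> h" "h \<le> d / 2" for h t
  proof (cases "h > 0")
    case True
    have "of_int \<lfloor>t / h\<rfloor> * h \<le> t" "t < (of_int \<lfloor>t / h\<rfloor> + 1) * h"
      using floor_divide_lower[OF True] floor_divide_upper[OF True] by auto
    then have "\<bar>of_int \<lfloor>t / h\<rfloor> * h - t\<bar> < d" using h d(1) True by (simp add: algebra_simps abs_if)
    then show ?thesis using d(2)[of "of_int \<lfloor>t / h\<rfloor> * h" t] True by (simp add: step_approx_def dist_real_def)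
  qed (use e in \<open>simp add: step_approx_def\<close>)
  then show ?thesis using that[of "d / 2"] d by simp
qed

lemma step_approx_riccati:
  assumes "riccati \<Gamma> q D B" "continuous_on UNIV \<Gamma>"
  shows "riccati (step_approx h \<Gamma>) q D B"
proof -
  interpret riccati \<Gamma> q D B by fact
  show ?thesis
  proof
    have "(\<lambda>t. \<Gamma> (of_int \<lfloor>t / h\<rfloor> * h)) \<in> borel_measurable borel" by measurable
    then show "step_approx h \<Gamma> \<in> borel_measurable borel"
      unfolding step_approx_def by (cases "h > 0") auto
    show "\<bar>step_approx h \<Gamma> t\<bar> \<le> D" for t using \<Delta>_le by (simp add: step_approx_def)
  qed (auto simp: q_le)
qed

text \<open>\<open>Bfun\<close> bounds \<open>y\<close> only near -infinity, and \<open>y\<close> is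
  arbitrary beyond \<open>s\<close>. On the remaining compact piece \<open>y\<close> is an
  indefinite integral, hence continuous and bounded; setting it to 0 after \<open>s\<close> makes it
  Borel on the whole line.\<close>

lemma (in riccati) bounded_half_line_solution:
  assumes y: "integral_solution g {..s} y" and B: "Bfun y at_bot"
  obtains z R where "integral_solution g {..s} z" "z s = y s" "z \<in> borel_measurable borel"
    "\<And>t. t \<le> s \<Longrightarrow> \<bar>z t\<bar> \<le> R"
proof -
  obtain K T where K: "\<And>t. t \<le> T \<Longrightarrow> \<bar>y t\<bar> \<le> K"
    using B by (auto simp: Bfun_def eventually_at_bot_linorder)
  define u where "u = min T s"
  have u: "u \<le> s" "u \<le> T" by (auto simp: u_def)
  have "(\<lambda>l. g l (y l)) integrable_on {u..s}"
    using integral_solutionD[OF y _ _ u(1)] u(1) by (auto intro: has_integral_integrable)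
  then have cont: "continuous_on {u..s} (\<lambda>t. y u + integral {u..t} (\<lambda>l. g l (y l)))"
    by (intro continuous_intros indefinite_integral_continuous_1)
  have "y u + integral {u..t} (\<lambda>l. g l (y l)) = y t" if "t \<in> {u..s}" for t
    using integral_unique[OF integral_solutionD[OF y, of u t]] that by auto
  then have "continuous_on {u..s} y" by (rule continuous_on_eq[OF cont])
  then have "bounded (y ` {u..s})" by (intro compact_imp_bounded compact_continuous_image) auto
  then obtain K' where K': "\<And>t. t \<in> {u..s} \<Longrightarrow> \<bar>y t\<bar> \<le> K'"
    unfolding bounded_iff real_norm_def by (metis imageI)
  define R where "R = max K K'"
  have R: "\<bar>y t\<bar> \<le> R" if "t \<le> s" for t
  proof (cases "t \<le> u")
    case True then have "\<bar>y t\<bar> \<le> K" using u by (intro K) auto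
    then show ?thesis by (simp add: R_def)
  next
    case False then have "\<bar>y t\<bar> \<le> K'" using that by (intro K') auto
    then show ?thesis by (simp add: R_def)
  qed
  define z where "z t = indicator {..s} t * y t" for t
  have "((R + D)\<^sup>2 + B)-lipschitz_on {..s} y"
  proof (rule lipschitz_on_leI)
    show nn: "0 \<le> (R + D)\<^sup>2 + B" using B_nonneg by simp
    fix v t assume vt: "v \<in> {..s}" "t \<in> {..s}" "v \<le> t"
    have "((R + D)\<^sup>2 + B)-lipschitz_on {v..t} y"
      by (rule has_integral_imp_lipschitz_on[OF integral_solutionD[OF y]])
         (use nn quad_rhs_bound[OF R] vt in auto)
    then show "dist (y v) (y t) \<le> ((R + D)\<^sup>2 + B) * dist v t"
      by (rule lipschitz_onD) (use vt in auto)
  qed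
  then have "z \<in> borel_measurable borel"
    using borel_measurable_continuous_on_indicator[of "{..s}" y] lipschitz_on_continuous_on
    unfolding z_def by force
  moreover have "integral_solution g {..s} z"
    unfolding integral_solution_def
  proof (intro ballI impI)
    fix v t assume vt: "v \<in> {..s}" "t \<in> {..s}" "v \<le> t"
    have "((\<lambda>l. g l (z l)) has_integral y t - y v) {v..t}"
      by (rule has_integral_eq[OF _ integral_solutionD[OF y vt]]) (use vt in \<open>auto simp: z_def\<close>)
    then show "((\<lambda>l. g l (z l)) has_integral z t - z v) {v..t}" using vt by (simp add: z_def)
  qed
  moreover have "\<bar>z t\<bar> \<le> R" if "t \<le> s" for t using R[OF that] that by (simp add: z_def)
  ultimately show ?thesis using that[of z R] by (simp add: z_def)
qed

lemma (in riccati) bounded_half_line_solution_right: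
  assumes y: "integral_solution g {s..} y" and B: "Bfun y at_top"
  obtains z R where "integral_solution g {s..} z" "z s = y s" "z \<in> borel_measurable borel"
    "\<And>t. s \<le> t \<Longrightarrow> \<bar>z t\<bar> \<le> R"
proof -
  interpret refl: riccati "\<lambda>t. - \<Delta> (- t)" "\<lambda>t. q (- t)" D B by (rule riccati_reflect)
  have half: "uminus ` {s..} = {..- s}" "uminus ` {..- s} = {s..}" by auto
  have y': "integral_solution refl.g {..- s} (\<lambda>t. - y (- t))"
    using integral_solution_reflect[OF y] by (simp add: quad_rhs_reflect half)
  obtain K T where K: "K > 0" "\<And>t. t \<ge> T \<Longrightarrow> \<bar>y t\<bar> \<le> K"
    using B by (auto simp: Bfun_def eventually_at_top_linorder)
  have B': "Bfun (\<lambda>t. - y (- t)) at_bot"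
    unfolding Bfun_def eventually_at_bot_linorder
    by (intro exI[of _ K] conjI K(1) exI[of _ "- T"]) (use K(2) in auto)
  obtain z R where z: "integral_solution refl.g {..- s} z" "z (- s) = - y (- (- s))" "z \<in> borel_measurable borel"
    "\<And>t. t \<le> - s \<Longrightarrow> \<bar>z t\<bar> \<le> R"
    using refl.bounded_half_line_solution[OF y' B'] by blast
  note [measurable] = z(3)
  have "integral_solution g {s..} (\<lambda>t. - z (- t))"
    using integral_solution_reflect[OF z(1)] by (simp add: quad_rhs_reflect half)
  then show ?thesis using that[of "\<lambda>t. - z (- t)" R] z by auto
qed

section \<open>Assembly of one strict lower function for all small step sizes\<close>

theorem theorem6p8:
  fixes p \<Gamma> \<Gamma>' \<Gamma>'' a r a0 r0 :: "real \<Rightarrow> real"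
    and Da Dr :: "real set"
    and \<alpha> t1 t2 :: real
  assumes p: "Linfty p"
    and pair: "attractor_repeller_pair (\<lambda>_. 0) p a r"
    and \<Gamma>_bounded: "bounded (range \<Gamma>)"
    and \<Gamma>_cont: "continuous_on UNIV \<Gamma>"
    and \<Gamma>_lim_top: "\<exists>L. (\<Gamma> \<longlongrightarrow> L) at_top"
    and \<Gamma>_lim_bot: "\<exists>L. (\<Gamma> \<longlongrightarrow> L) at_bot"
    and \<alpha>: "0 < \<alpha>" "\<alpha> < 1 / 2"
    and a0: "special_solution_a (step_approx 0 \<Gamma>) p Da a0"
    and r0: "special_solution_r (step_approx 0 \<Gamma>) p Dr r0"
    and t12: "t1 < t2"
    and t1: "t1 \<in> Da" "a0 t1 - \<Gamma> t1 > convex_comb a r (1 / 2 + \<alpha>) t1"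
    and t2: "t2 \<in> Dr" "r0 t2 - \<Gamma> t2 < convex_comb a r (1 / 2 - \<alpha>) t2"
    and \<Gamma>'_deriv:
      "\<And>t. t \<in> {t1..t2} \<Longrightarrow> (\<Gamma> has_real_derivative \<Gamma>' t) (at t within {t1..t2})"
    and \<Gamma>''_deriv:
      "\<And>t. t \<in> {t1..t2} \<Longrightarrow> (\<Gamma>' has_real_derivative \<Gamma>'' t) (at t within {t1..t2})"
    and \<Gamma>''_cont: "continuous_on {t1..t2} \<Gamma>''"
    and ineq: "\<And>t. t \<in> {t1..t2} \<Longrightarrow>
      (1 / 4 - \<alpha>\<^sup>2 * (t2 + t1 - 2 * t)\<^sup>2 / (t2 - t1)\<^sup>2) * (a t - r t)\<^sup>2
        + 2 * \<alpha> / (t2 - t1) * (a t - r t) > \<Gamma>' t"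
  shows "\<exists>hs>0. \<forall>h\<in>{0..hs}. has_attractor_repeller_pair (step_approx h \<Gamma>) p"
proof -
  obtain p' B where p': "p' \<in> borel_measurable borel" "\<And>t. \<bar>p' t\<bar> \<le> B" "AE t in lebesgue. p t = p' t"
    using Linfty_borel_representative[OF p] by blast
  obtain D where D: "\<And>t. \<bar>\<Gamma> t\<bar> \<le> D" using \<Gamma>_bounded by (auto simp: bounded_iff)
  have ric: "riccati \<Gamma> p' D B"
    using p' D borel_measurable_continuous_onI[OF \<Gamma>_cont] by unfold_locales auto
  have ric0: "riccati (\<lambda>_. 0) p' 0 B" using p' by unfold_locales auto
  interpret riccati \<Gamma> p' D B by (rule ric)
  interpret z: riccati "\<lambda>_. 0" p' 0 B by (rule ric0)
  have pair': "attractor_repeller_pair (\<lambda>_. 0) p' a r"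
    using pair by (simp add: attractor_repeller_pair_AE_cong[OF p'(3)])
  then have bs: "bounded_solution z.g a" "bounded_solution z.g r"
    by (simp_all add: attractor_repeller_pair_def)
  then have a: "integral_solution z.g UNIV a" and r: "integral_solution z.g UNIV r"
    by (auto simp: bounded_solution_def intro: caratheodory_imp_integral_solution)
  obtain Ra Rr where "\<And>t. \<bar>a t\<bar> \<le> Ra" "\<And>t. \<bar>r t\<bar> \<le> Rr"
    using bs by (auto simp: bounded_solution_def bounded_iff)
  then have aR: "\<bar>a t\<bar> \<le> max Ra Rr" and rR: "\<bar>r t\<bar> \<le> max Ra Rr" for t
    by (auto simp: le_max_iff_disj)
  obtain \<kappa> where \<kappa>: "\<kappa> > 0" "\<And>t. \<kappa> \<le> a t - r t" using z.pair_imp_separated[OF pair'] by blast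
  have step0: "step_approx 0 \<Gamma> = \<Gamma>" by (auto simp: step_approx_def)
  obtain L1 L2 where L: "(\<Gamma> \<longlongrightarrow> L1) at_bot" "(\<Gamma> \<longlongrightarrow> L2) at_top"
    using \<Gamma>_lim_top \<Gamma>_lim_bot by blast

  \<comment> \<open>The equivalence that characterizes \<open>a0\<close>, read at its own value
    \<open>a0 t1\<close>, supplies a solution on the past of \<open>t1\<close> that is bounded near
    -infinity. The solution \<open>w0\<close> comes from \<open>r0\<close> in the same way.\<close>
  obtain y0 where "caratheodory_solution (quad_rhs \<Gamma> p) {..t1} y0" and y0: "y0 t1 = a0 t1" "Bfun y0 at_bot"
    using a0 t1(1) unfolding special_solution_a_def step0 by blast
  then have "integral_solution g {..t1} y0"
    by (simp add: caratheodory_solution_AE_cong[OF p'(3)] caratheodory_imp_integral_solution)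
  then obtain y1 R1 where y1: "integral_solution g {..t1} y1" "y1 t1 = a0 t1" "y1 \<in> borel_measurable borel"
    "\<And>t. t \<le> t1 \<Longrightarrow> \<bar>y1 t\<bar> \<le> R1"
    using bounded_half_line_solution[OF _ y0(2)] y0(1) by metis
  obtain w0 where "caratheodory_solution (quad_rhs \<Gamma> p) {t2..} w0" and w0: "w0 t2 = r0 t2" "Bfun w0 at_top"
    using r0 t2(1) unfolding special_solution_r_def step0 by blast
  then have "integral_solution g {t2..} w0"
    by (simp add: caratheodory_solution_AE_cong[OF p'(3)] caratheodory_imp_integral_solution)
  then obtain y2 R2 where y2: "integral_solution g {t2..} y2" "y2 t2 = r0 t2" "y2 \<in> borel_measurable borel"
    "\<And>t. t2 \<le> t \<Longrightarrow> \<bar>y2 t\<bar> \<le> R2"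
    using bounded_half_line_solution_right[OF _ w0(2)] w0(1) by metis
  define R where "R = max (max Ra Rr) (max R1 R2)"
  have bR: "\<bar>a t\<bar> \<le> R" "\<bar>r t\<bar> \<le> R" for t using aR[of t] rR[of t] by (auto simp: R_def)
  have yR: "t \<le> t1 \<Longrightarrow> \<bar>y1 t\<bar> \<le> R" "t2 \<le> t \<Longrightarrow> \<bar>y2 t\<bar> \<le> R" for t
    using y1(4)[of t] y2(4)[of t] by (auto simp: R_def)
  note am = z.solution_meas[OF a aR] and rm = z.solution_meas[OF r rR]

  define b where "b t = (1 / 2 + \<alpha> * (t2 + t1 - 2 * t) / (t2 - t1)) * a t
      + (1 - (1 / 2 + \<alpha> * (t2 + t1 - 2 * t) / (t2 - t1))) * r t + \<Gamma> t" for t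
  have "continuous_on {t1..t2} \<Gamma>'"
    using DERIV_continuous[OF \<Gamma>''_deriv] by (auto simp: continuous_on_eq_continuous_within)
  then obtain \<delta>2 B2 where mid: "\<delta>2 > 0" "lower_function (quad_rhs \<Gamma> (\<lambda>t. p' t - \<delta>2)) {t1..t2} b"
    "\<And>t. t \<in> {t1..t2} \<Longrightarrow> \<bar>b t\<bar> \<le> B2" "b \<in> borel_measurable borel"
    using strict_lower_function_middle[OF ric ric0 a aR r rR t12 \<Gamma>'_deriv _ ineq] unfolding b_def by blast
  have b_ends: "b t1 = convex_comb a r (1 / 2 + \<alpha>) t1 + \<Gamma> t1" "b t2 = convex_comb a r (1 / 2 - \<alpha>) t2 + \<Gamma> t2"
  proof -
    have "\<alpha> * (t2 + t1 - 2 * t1) / (t2 - t1) = \<alpha>" "\<alpha> * (t2 + t1 - 2 * t2) / (t2 - t1) = - \<alpha>"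
      using t12 by (simp_all add: field_simps)
    then show "b t1 = convex_comb a r (1 / 2 + \<alpha>) t1 + \<Gamma> t1" "b t2 = convex_comb a r (1 / 2 - \<alpha>) t2 + \<Gamma> t2"
      unfolding b_def convex_comb_def by simp_all
  qed
  \<comment> \<open>These gaps are the heights that the outer pieces may lose: the left piece still
    ends at or above \<open>b t1\<close>, and the right piece still starts at or below
    \<open>b t2\<close>, as gluing requires.\<close>
  have \<theta>1: "y1 t1 - b t1 > 0" and \<theta>2: "b t2 - y2 t2 > 0" using t1(2) t2(2) b_ends y1(2) y2(2) by auto
  obtain \<delta>1 b1 B1 where left: "\<delta>1 > 0" "b1 \<in> borel_measurable borel" "\<And>t. t \<le> t1 \<Longrightarrow> \<bar>b1 t\<bar> \<le> B1"
    "lower_function (quad_rhs \<Gamma> (\<lambda>t. p' t - \<delta>1)) {..t1} b1" "y1 t1 - (y1 t1 - b t1) \<le> b1 t1"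
    by (rule strict_lower_function_left[OF ric y1(1,3) yR(1) a am bR(1) r rm bR(2) \<kappa> L(1) \<theta>1], assumption)
       (rule that; assumption)
  obtain \<delta>3 b3 B3 where right: "\<delta>3 > 0" "b3 \<in> borel_measurable borel" "\<And>t. t2 \<le> t \<Longrightarrow> \<bar>b3 t\<bar> \<le> B3"
    "lower_function (quad_rhs \<Gamma> (\<lambda>t. p' t - \<delta>3)) {t2..} b3" "b3 t2 \<le> y2 t2 + (b t2 - y2 t2)"
    by (rule strict_lower_function_right[OF ric y2(1,3) yR(2) a am bR(1) r rm bR(2) \<kappa> L(2) \<theta>2], assumption)
       (rule that; assumption)
  define \<delta> where "\<delta> = min \<delta>2 (min \<delta>1 \<delta>3)"
  have \<delta>: "\<delta> > 0" "\<delta> \<le> \<delta>1" "\<delta> \<le> \<delta>2" "\<delta> \<le> \<delta>3" using left(1) mid(1) right(1) by (auto simp: \<delta>_def)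
  define b12 where "b12 t = (if t < t1 then b1 t else b t)" for t
  define b123 where "b123 t = (if t < t2 then b12 t else b3 t)" for t
  have sets: "{..t2} \<inter> {..t1} = {..t1}" "{..t2} \<inter> {t1..} = {t1..t2}" using t12 by auto
  have low12: "lower_function (quad_rhs \<Gamma> (\<lambda>t. p' t - \<delta>)) {..t2} b12"
    unfolding b12_def using t12 left(5)
    by (intro lower_function_glue)
       (auto simp: sets is_interval_ic intro: lower_function_decrease[OF left(4) \<delta>(2)] lower_function_decrease[OF mid(2) \<delta>(3)])
  have "b3 t2 \<le> b12 t2" using t12 right(5) by (simp add: b12_def)
  then have low: "lower_function (quad_rhs \<Gamma> (\<lambda>t. p' t - \<delta>)) UNIV b123"
    unfolding b123_def
    by (intro lower_function_glue)
       (use low12 lower_function_decrease[OF right(4) \<delta>(4)] in simp_all)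
  note [measurable] = left(2) mid(4) right(2)
  have meas: "b123 \<in> borel_measurable borel" unfolding b123_def b12_def by measurable
  define M where "M = max B1 (max B2 B3)"
  have bM: "\<bar>b123 t\<bar> \<le> M" for t
    using left(3)[of t] mid(3)[of t] right(3)[of t] by (auto simp: b123_def b12_def M_def le_max_iff_disj)
  have M0: "M \<ge> 0" using bM[of 0] by linarith
  \<comment> \<open>Chosen for \<open>lower_function_perturb\<close>: the slack then absorbs a
    change of \<open>\<Gamma>\<close> by \<open>e\<close> together with a vertical shift by
    \<open>e\<close>.\<close>
  define e where "e = min 1 (\<delta> / (4 * (M + D + 1)))"
  have e: "e > 0" "e \<le> 1" "4 * e * (M + D + 1) \<le> \<delta>"
  proof -
    have pos: "4 * (M + D + 1) > 0" using M0 D_nonneg by simp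
    then show "e > 0" "e \<le> 1" using \<delta>(1) by (auto simp: e_def)
    have "e \<le> \<delta> / (4 * (M + D + 1))" by (simp add: e_def)
    then show "4 * e * (M + D + 1) \<le> \<delta>" using pos by (simp add: pos_le_divide_eq algebra_simps)
  qed
  obtain hs where hs: "hs > 0" "\<And>h t. 0 \<le> h \<Longrightarrow> h \<le> hs \<Longrightarrow> \<bar>step_approx h \<Gamma> t - \<Gamma> t\<bar> \<le> e"
    using step_approx_uniform[OF uniformly_continuous_on_real_limits[OF \<Gamma>_cont L(2,1)] e(1)] by blast
  have "has_attractor_repeller_pair (step_approx h \<Gamma>) p" if h: "h \<in> {0..hs}" for h
  proof -
    interpret s: riccati "step_approx h \<Gamma>" p' D B by (rule step_approx_riccati[OF ric \<Gamma>_cont])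
    have near: "\<bar>step_approx h \<Gamma> t - \<Gamma> t\<bar> \<le> e" for t using hs(2) h by auto
    \<comment> \<open>The shifts \<open>c = e\<close> and \<open>c = - e\<close> are the two copies
      that \<open>lower_functions_imp_pair\<close> asks for.\<close>
    have pert: "lower_function s.g UNIV (\<lambda>t. b123 t + c)" if "\<bar>c\<bar> \<le> e" for c
      by (rule lower_function_perturb[OF low meas bM D s.riccati_axioms near that e(2,3)])
    have "has_attractor_repeller_pair (step_approx h \<Gamma>) p'"
      using s.lower_functions_imp_pair[OF e(1) bM] pert[of e] pert[of "- e"] e(1) by simp
    then show ?thesis by (simp add: has_attractor_repeller_pair_def attractor_repeller_pair_AE_cong[OF p'(3)])
  qed
  then show ?thesis using hs(1) by blast
qed

end
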